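(* The category $\mathrm{nsSet}$ of non-singular simplicial sets is a cartesian closed category with all (small) limits and colimits.
   Context: A simplicial set $X$ is non-singular if for each $n\ge0$ and each non-degenerate simplex $x\in X_n$ the representing map $\bar x\colon\Delta[n]\to X$ (corresponding to $x$ under the Yoneda lemma) is degreewise injective. $\mathrm{nsSet}$ denotes the full subcategory of the category of simplicial sets on the non-singular simplicial sets. *)

theory Defs
  imports Complex_Main "HOL-Library.FuncSet"
begin

unbundle cardinal_syntax

section \<open>Categories, limits, colimits, exponentials\<close>

text \<open>Composition is written in the usual order: \<open>cmp C g f\<close> is ``g after f''.\<close>

record ('o, 'a) cat =
  ob :: "'o set"
  arr :: "'a set"
  dm :: "'a \<Rightarrow> 'o"
  cd :: "'a \<Rightarrow> 'o"
  ide :: "'o \<Rightarrow> 'a"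
  cmp :: "'a \<Rightarrow> 'a \<Rightarrow> 'a"

definition hom :: "('o, 'a) cat \<Rightarrow> 'o \<Rightarrow> 'o \<Rightarrow> 'a set" where
  "hom C A B = {f \<in> arr C. dm C f = A \<and> cd C f = B}"

locale category =
  fixes C :: "('o, 'a) cat"
  assumes dm_ob: "f \<in> arr C \<Longrightarrow> dm C f \<in> ob C"
    and cd_ob: "f \<in> arr C \<Longrightarrow> cd C f \<in> ob C"
    and ide_hom: "A \<in> ob C \<Longrightarrow> ide C A \<in> hom C A A"
    and cmp_hom: "\<lbrakk>f \<in> hom C A B; g \<in> hom C B D\<rbrakk> \<Longrightarrow> cmp C g f \<in> hom C A D"
    and ide_right: "f \<in> hom C A B \<Longrightarrow> cmp C f (ide C A) = f"
    and ide_left: "f \<in> hom C A B \<Longrightarrow> cmp C (ide C B) f = f"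
    and cmp_assoc: "\<lbrakk>f \<in> hom C A B; g \<in> hom C B D; h \<in> hom C D E\<rbrakk>
        \<Longrightarrow> cmp C h (cmp C g f) = cmp C (cmp C h g) f"

definition full_subcategory :: "('o, 'a) cat \<Rightarrow> ('o \<Rightarrow> bool) \<Rightarrow> ('o, 'a) cat" where
  "full_subcategory C P =
     C\<lparr>ob := {A \<in> ob C. P A}, arr := {f \<in> arr C. P (dm C f) \<and> P (cd C f)}\<rparr>"

locale diagram = J: category J + C: category C
  for J :: "('j, 'k) cat" and C :: "('o, 'a) cat" +
  fixes Fo :: "'j \<Rightarrow> 'o" and Fa :: "'k \<Rightarrow> 'a"
  assumes on_ob: "j \<in> ob J \<Longrightarrow> Fo j \<in> ob C"
    and on_hom: "u \<in> hom J i j \<Longrightarrow> Fa u \<in> hom C (Fo i) (Fo j)"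
    and on_ide: "j \<in> ob J \<Longrightarrow> Fa (ide J j) = ide C (Fo j)"
    and on_cmp: "\<lbrakk>u \<in> hom J i j; v \<in> hom J j k\<rbrakk> \<Longrightarrow> Fa (cmp J v u) = cmp C (Fa v) (Fa u)"

definition is_cone ::
  "('j, 'k) cat \<Rightarrow> ('o, 'a) cat \<Rightarrow> ('j \<Rightarrow> 'o) \<Rightarrow> ('k \<Rightarrow> 'a) \<Rightarrow> 'o \<Rightarrow> ('j \<Rightarrow> 'a) \<Rightarrow> bool" where
  "is_cone J C Fo Fa L p \<longleftrightarrow>
     L \<in> ob C \<and> (\<forall>j\<in>ob J. p j \<in> hom C L (Fo j)) \<and>
     (\<forall>u\<in>arr J. cmp C (Fa u) (p (dm J u)) = p (cd J u))"

definition is_limit ::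
  "('j, 'k) cat \<Rightarrow> ('o, 'a) cat \<Rightarrow> ('j \<Rightarrow> 'o) \<Rightarrow> ('k \<Rightarrow> 'a) \<Rightarrow> 'o \<Rightarrow> ('j \<Rightarrow> 'a) \<Rightarrow> bool" where
  "is_limit J C Fo Fa L p \<longleftrightarrow>
     is_cone J C Fo Fa L p \<and>
     (\<forall>M q. is_cone J C Fo Fa M q \<longrightarrow>
        (\<exists>!h. h \<in> hom C M L \<and> (\<forall>j\<in>ob J. cmp C (p j) h = q j)))"

definition is_cocone ::
  "('j, 'k) cat \<Rightarrow> ('o, 'a) cat \<Rightarrow> ('j \<Rightarrow> 'o) \<Rightarrow> ('k \<Rightarrow> 'a) \<Rightarrow> 'o \<Rightarrow> ('j \<Rightarrow> 'a) \<Rightarrow> bool" where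
  "is_cocone J C Fo Fa L p \<longleftrightarrow>
     L \<in> ob C \<and> (\<forall>j\<in>ob J. p j \<in> hom C (Fo j) L) \<and>
     (\<forall>u\<in>arr J. cmp C (p (cd J u)) (Fa u) = p (dm J u))"

definition is_colimit ::
  "('j, 'k) cat \<Rightarrow> ('o, 'a) cat \<Rightarrow> ('j \<Rightarrow> 'o) \<Rightarrow> ('k \<Rightarrow> 'a) \<Rightarrow> 'o \<Rightarrow> ('j \<Rightarrow> 'a) \<Rightarrow> bool" where
  "is_colimit J C Fo Fa L p \<longleftrightarrow>
     is_cocone J C Fo Fa L p \<and>
     (\<forall>M q. is_cocone J C Fo Fa M q \<longrightarrow>
        (\<exists>!h. h \<in> hom C L M \<and> (\<forall>j\<in>ob J. cmp C h (p j) = q j)))"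

definition has_limits_of_shape :: "('j, 'k) cat \<Rightarrow> ('o, 'a) cat \<Rightarrow> bool" where
  "has_limits_of_shape J C \<longleftrightarrow>
     (\<forall>Fo Fa. diagram J C Fo Fa \<longrightarrow> (\<exists>L p. is_limit J C Fo Fa L p))"

definition has_colimits_of_shape :: "('j, 'k) cat \<Rightarrow> ('o, 'a) cat \<Rightarrow> bool" where
  "has_colimits_of_shape J C \<longleftrightarrow>
     (\<forall>Fo Fa. diagram J C Fo Fa \<longrightarrow> (\<exists>L p. is_colimit J C Fo Fa L p))"

definition is_terminal :: "('o, 'a) cat \<Rightarrow> 'o \<Rightarrow> bool" where
  "is_terminal C T \<longleftrightarrow> T \<in> ob C \<and> (\<forall>A\<in>ob C. \<exists>!f. f \<in> hom C A T)"

definition is_product :: "('o, 'a) cat \<Rightarrow> 'o \<Rightarrow> 'o \<Rightarrow> 'o \<Rightarrow> 'a \<Rightarrow> 'a \<Rightarrow> bool" where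
  "is_product C A B P p q \<longleftrightarrow>
     P \<in> ob C \<and> p \<in> hom C P A \<and> q \<in> hom C P B \<and>
     (\<forall>X\<in>ob C. \<forall>f\<in>hom C X A. \<forall>g\<in>hom C X B.
        \<exists>!h. h \<in> hom C X P \<and> cmp C p h = f \<and> cmp C q h = g)"

text \<open>
  \<open>E\<close> is an exponential of \<open>B\<close> by \<open>A\<close>, with evaluation \<open>ev\<close> from a product \<open>P\<close> of \<open>E\<close> and \<open>A\<close>.
  In the universal property, \<open>t\<close> is the product of \<open>h\<close> with the identity of \<open>A\<close>.
\<close>

definition is_exponential ::
  "('o, 'a) cat \<Rightarrow> 'o \<Rightarrow> 'o \<Rightarrow> 'o \<Rightarrow> 'o \<Rightarrow> 'a \<Rightarrow> 'a \<Rightarrow> 'a \<Rightarrow> bool" where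
  "is_exponential C A B E P p q ev \<longleftrightarrow>
     is_product C E A P p q \<and> ev \<in> hom C P B \<and>
     (\<forall>X Q r s. is_product C X A Q r s \<longrightarrow>
       (\<forall>f\<in>hom C Q B. \<exists>!h. h \<in> hom C X E \<and>
          (\<exists>t\<in>hom C Q P. cmp C p t = cmp C h r \<and> cmp C q t = s \<and> cmp C ev t = f)))"

definition cartesian_closed :: "('o, 'a) cat \<Rightarrow> bool" where
  "cartesian_closed C \<longleftrightarrow>
     (\<exists>T. is_terminal C T) \<and>
     (\<forall>A\<in>ob C. \<forall>B\<in>ob C. \<exists>P p q. is_product C A B P p q) \<and>
     (\<forall>A\<in>ob C. \<forall>B\<in>ob C. \<exists>E P p q ev. is_exponential C A B E P p q ev)"

section \<open>Smallness\<close>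

text \<open>
  HOL has no type of all sets, so smallness is relative to a universe: a type \<open>'u\<close> whose
  cardinality is strongly inaccessible, i.e. uncountable, regular and a strong limit.
  A set, of elements of any type, is small if it has fewer elements than \<open>'u\<close>; up to bijection
  the small sets are the elements of the Grothendieck universe with that cardinal.
\<close>

definition universe :: "'u itself \<Rightarrow> bool" where
  "universe _ \<longleftrightarrow>
     natLeq <o |UNIV :: 'u set| \<and>
     regularCard |UNIV :: 'u set| \<and>
     (\<forall>A :: 'u set. |A| <o |UNIV :: 'u set| \<longrightarrow> |Pow A| <o |UNIV :: 'u set| )"

definition small :: "'u itself \<Rightarrow> 'b set \<Rightarrow> bool" where
  "small _ A \<longleftrightarrow> |A| <o |UNIV :: 'u set|"

definition small_category :: "'u itself \<Rightarrow> ('j, 'k) cat \<Rightarrow> bool" where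
  "small_category U J \<longleftrightarrow> category J \<and> small U (ob J) \<and> small U (arr J)"

section \<open>Simplicial sets\<close>

text \<open>The arrows from \<open>[m]\<close> to \<open>[n]\<close> of the simplex category, where \<open>[n] = {0, \<dots>, n}\<close>.\<close>

definition simplex_hom :: "nat \<Rightarrow> nat \<Rightarrow> (nat \<Rightarrow> nat) set" where
  "simplex_hom m n = {\<alpha> \<in> {..m} \<rightarrow>\<^sub>E {..n}. mono_on {..m} \<alpha>}"

text \<open>\<open>act X m n \<alpha>\<close> is the operator from \<open>n\<close>-simplices to \<open>m\<close>-simplices induced by
  \<open>\<alpha> : [m] \<rightarrow> [n]\<close>.\<close>

record 'a sset =
  simp :: "nat \<Rightarrow> 'a set"
  act :: "nat \<Rightarrow> nat \<Rightarrow> (nat \<Rightarrow> nat) \<Rightarrow> 'a \<Rightarrow> 'a"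

locale simplicial_set =
  fixes X :: "'a sset"
  assumes act_closed:
      "\<lbrakk>\<alpha> \<in> simplex_hom m n; x \<in> simp X n\<rbrakk> \<Longrightarrow> act X m n \<alpha> x \<in> simp X m"
    and act_id: "x \<in> simp X n \<Longrightarrow> act X n n (\<lambda>i\<in>{..n}. i) x = x"
    and act_comp:
      "\<lbrakk>\<beta> \<in> simplex_hom k m; \<alpha> \<in> simplex_hom m n; x \<in> simp X n\<rbrakk>
        \<Longrightarrow> act X k m \<beta> (act X m n \<alpha> x) = act X k n (compose {..k} \<alpha> \<beta>) x"

record ('a, 'b) smap =
  src :: "'a sset"
  tgt :: "'b sset"
  app :: "nat \<Rightarrow> 'a \<Rightarrow> 'b"

definition simplicial_map :: "('a, 'b) smap \<Rightarrow> bool" where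
  "simplicial_map f \<longleftrightarrow>
     simplicial_set (src f) \<and> simplicial_set (tgt f) \<and>
     (\<forall>n. app f n \<in> simp (src f) n \<rightarrow>\<^sub>E simp (tgt f) n) \<and>
     (\<forall>m n. \<forall>\<alpha>\<in>simplex_hom m n. \<forall>x\<in>simp (src f) n.
        app f m (act (src f) m n \<alpha> x) = act (tgt f) m n \<alpha> (app f n x))"

definition sSet :: "('u sset, ('u, 'u) smap) cat" where
  "sSet = \<lparr>
     ob = {X. simplicial_set X \<and> (\<forall>n. small TYPE('u) (simp X n))},
     arr = {f. simplicial_map f \<and> (\<forall>n. small TYPE('u) (simp (src f) n))
             \<and> (\<forall>n. small TYPE('u) (simp (tgt f) n))},
     dm = src,
     cd = tgt,
     ide = (\<lambda>X. \<lparr>src = X, tgt = X, app = (\<lambda>n. \<lambda>x\<in>simp X n. x)\<rparr>),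
     cmp = (\<lambda>g f. \<lparr>src = src f, tgt = tgt g,
             app = (\<lambda>n. compose (simp (src f) n) (app g n) (app f n))\<rparr>)\<rparr>"

section \<open>Non-singular simplicial sets\<close>

definition std_simplex :: "nat \<Rightarrow> (nat \<Rightarrow> nat) sset" where
  "std_simplex n = \<lparr>
     simp = (\<lambda>m. simplex_hom m n),
     act = (\<lambda>k m \<beta> \<alpha>. compose {..k} \<alpha> \<beta>)\<rparr>"

definition representing_map :: "'a sset \<Rightarrow> nat \<Rightarrow> 'a \<Rightarrow> (nat \<Rightarrow> nat, 'a) smap" where
  "representing_map X n x = \<lparr>
     src = std_simplex n,
     tgt = X,
     app = (\<lambda>m. \<lambda>\<alpha>\<in>simplex_hom m n. act X m n \<alpha> x)\<rparr>"

definition degenerate :: "'a sset \<Rightarrow> nat \<Rightarrow> 'a \<Rightarrow> bool" where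
  "degenerate X n x \<longleftrightarrow>
     (\<exists>m<n. \<exists>\<sigma>\<in>simplex_hom n m. \<sigma> ` {..n} = {..m} \<and> (\<exists>y\<in>simp X m. x = act X n m \<sigma> y))"

definition degreewise_injective :: "('a, 'b) smap \<Rightarrow> bool" where
  "degreewise_injective f \<longleftrightarrow> (\<forall>m. inj_on (app f m) (simp (src f) m))"

definition non_singular :: "'a sset \<Rightarrow> bool" where
  "non_singular X \<longleftrightarrow>
     (\<forall>n. \<forall>x\<in>simp X n. \<not> degenerate X n x \<longrightarrow> degreewise_injective (representing_map X n x))"

definition nsSet :: "('u sset, ('u, 'u) smap) cat" where
  "nsSet = full_subcategory sSet non_singular"

end

theory Submission
  imports Defs
begin

text \<open>
  A simplicial set \<open>X\<close> is non-singular if and only if every simplex of \<open>X\<close> two of whose vertices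
  \<open>a < b\<close> agree is fixed by the operator that folds the vertex \<open>a + 1\<close> onto \<open>a\<close>
  (\<open>non_singular_iff\<close>). This is a family of Horn clauses: an equation between simplices implies
  another equation. The theorem follows from the behaviour of Horn clauses.

  Limits: a Horn clause passes to compatible families of simplices, so limits are computed as for
  simplicial sets (\<open>has_limits_nsSet\<close>).

  Colimits: relative to any generating relation there is a least congruence for which the quotient
  satisfies the Horn clauses, namely the one generated inductively (\<open>collapse\<close>), and each map into
  a non-singular simplicial set that respects the generators factors through the quotient
  (\<open>collapse_least\<close>). Applied to the disjoint union of a diagram, this quotient is the colimit
  (\<open>has_colimits_nsSet\<close>).

  Exponentials: the ordinary mapping space of simplicial maps \<open>A \<times> \<Delta>[n] \<rightarrow> B\<close> inherits the
  Horn clauses from \<open>B\<close> (\<open>vertex_closed_mapping_space\<close>), so it is an exponential among the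
  non-singular simplicial sets (\<open>exponential_exists\<close>).

  Each of these constructions takes place over some auxiliary type. Its simplices in each dimension
  form a small set, by the inaccessibility of the universe, and so they can be renamed by
  elements of the universe (\<open>nonsingular_quotient_exists\<close>, \<open>nonsingular_copy\<close>).
\<close>

section \<open>Small sets\<close>

lemma small_image: "small U A \<Longrightarrow> small U (f ` A)"
  unfolding small_def by (rule ordLeq_ordLess_trans[OF card_of_image])

lemma small_subset: "\<lbrakk>small U B; A \<subseteq> B\<rbrakk> \<Longrightarrow> small U A"
  unfolding small_def by (rule ordLeq_ordLess_trans[OF card_of_mono1])

lemma small_inj_into:
  assumes "small TYPE('u) (A :: 'b set)"
  shows "\<exists>e :: 'b \<Rightarrow> 'u. inj_on e A"
  using ordLess_imp_ordLeq[OF assms[unfolded small_def]] card_of_ordLeq[of A "UNIV :: 'u set"]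
  by blast

lemma universe_infinite:
  assumes "universe TYPE('u)"
  shows "infinite (UNIV :: 'u set)"
  using assms ordLess_imp_ordLeq infinite_iff_natLeq_ordLeq
  unfolding universe_def by blast

lemma small_nat:
  assumes "universe TYPE('u)"
  shows "small TYPE('u) (A :: nat set)"
proof -
  have "|A| \<le>o natLeq"
    using card_of_mono1[of A UNIV] card_of_nat by (rule ordLeq_ordIso_trans) simp
  moreover have "natLeq <o |UNIV :: 'u set|"
    using assms unfolding universe_def by simp
  ultimately show ?thesis
    unfolding small_def by (rule ordLeq_ordLess_trans)
qed

lemma small_finite:
  assumes "universe TYPE('u)" "finite A"
  shows "small TYPE('u) A"
  unfolding small_def
  by (rule ordLess_transitive[of _ natLeq])
    (use assms in \<open>simp_all add: universe_def finite_iff_ordLess_natLeq\<close>)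

text \<open>This is regularity of the cardinal of the universe, in the form of stability under disjoint unions.\<close>

lemma small_Sigma:
  assumes "universe TYPE('u)" "small TYPE('u) I" "\<And>i. i \<in> I \<Longrightarrow> small TYPE('u) (A i)"
  shows "small TYPE('u) (Sigma I A)"
proof -
  have "stable |UNIV :: 'u set|"
    using assms(1) universe_infinite[OF assms(1)]
    by (auto intro!: regularCard_stable[OF card_of_Card_order] simp: universe_def Field_card_of)
  then show ?thesis
      unfolding small_def by (rule stable_elim) (use assms(2,3) in \<open>simp_all add: small_def\<close>)
qed

lemma small_Pow:
  assumes "universe TYPE('u)" "small TYPE('u) (A :: 'b set)"
  shows "small TYPE('u) (Pow A)"
proof -
  obtain e :: "'b \<Rightarrow> 'u" where e: "inj_on e A"
    using small_inj_into[OF assms(2)] by blast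
  have "small TYPE('u) (Pow (e ` A))"
    using assms(1) small_image[OF assms(2), of e] by (simp add: universe_def small_def)
  then have "small TYPE('u) ((\<lambda>S. {x\<in>A. e x \<in> S}) ` Pow (e ` A))"
    by (rule small_image)
  moreover have "Pow A \<subseteq> (\<lambda>S. {x\<in>A. e x \<in> S}) ` Pow (e ` A)"
  proof
    fix S assume "S \<in> Pow A"
    then have "S = {x\<in>A. e x \<in> e ` S}" "e ` S \<in> Pow (e ` A)"
      using e by (auto dest: inj_onD)
    then show "S \<in> (\<lambda>S. {x\<in>A. e x \<in> S}) ` Pow (e ` A)"
      by (rule image_eqI)
  qed
  ultimately show ?thesis
    by (rule small_subset)
qed

text \<open>A function in the product is determined by its graph, a subset of the disjoint union.\<close>

lemma small_PiE:
  assumes "universe TYPE('u)" "small TYPE('u) I" "\<And>i. i \<in> I \<Longrightarrow> small TYPE('u) (A i)"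
  shows "small TYPE('u) (Pi\<^sub>E I A)"
proof -
  let ?un = "\<lambda>G. \<lambda>i\<in>I. THE y. (i, y) \<in> G"
  have "small TYPE('u) (?un ` Pow (Sigma I A))"
    using assms by (intro small_image small_Pow small_Sigma)
  moreover have "Pi\<^sub>E I A \<subseteq> ?un ` Pow (Sigma I A)"
  proof
    fix f assume f: "f \<in> Pi\<^sub>E I A"
    have "f = ?un ((\<lambda>i. (i, f i)) ` I)"
    proof
      fix i show "f i = ?un ((\<lambda>i. (i, f i)) ` I) i"
        using PiE_arb[OF f] by (cases "i \<in> I") (auto simp: image_iff)
    qed
    moreover have "(\<lambda>i. (i, f i)) ` I \<in> Pow (Sigma I A)"
      using f by auto
    ultimately show "f \<in> ?un ` Pow (Sigma I A)"
      by (rule image_eqI)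
  qed
  ultimately show ?thesis
    by (rule small_subset)
qed

section \<open>Operators of the simplex category\<close>

lemma simplex_hom_eq_iff:
  assumes "\<alpha> \<in> simplex_hom m n" "\<beta> \<in> simplex_hom m n"
  shows "\<alpha> = \<beta> \<longleftrightarrow> (\<forall>i\<le>m. \<alpha> i = \<beta> i)"
  using assms PiE_ext[of \<alpha> "{..m}" "\<lambda>_. {..n}" \<beta>] unfolding simplex_hom_def by auto

lemma simplex_hom_le: "\<lbrakk>\<alpha> \<in> simplex_hom m n; i \<le> m\<rbrakk> \<Longrightarrow> \<alpha> i \<le> n"
  unfolding simplex_hom_def by auto

lemma simplex_hom_mono: "\<lbrakk>\<alpha> \<in> simplex_hom m n; i \<le> j; j \<le> m\<rbrakk> \<Longrightarrow> \<alpha> i \<le> \<alpha> j"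
  unfolding simplex_hom_def mono_on_def by auto

lemma simplex_homI:
  assumes "\<And>i. i \<le> m \<Longrightarrow> g i \<le> n" "\<And>i j. \<lbrakk>i \<le> j; j \<le> m\<rbrakk> \<Longrightarrow> g i \<le> g j"
  shows "(\<lambda>i\<in>{..m}. g i) \<in> simplex_hom m n"
  using assms unfolding simplex_hom_def by (auto simp: mono_on_def)

lemma simplex_id: "(\<lambda>i\<in>{..n}. i) \<in> simplex_hom n n"
  by (rule simplex_homI) auto

lemma simplex_compose:
  assumes "\<beta> \<in> simplex_hom k m" "\<alpha> \<in> simplex_hom m n"
  shows "compose {..k} \<alpha> \<beta> \<in> simplex_hom k n"
  unfolding compose_def
  by (rule simplex_homI) (use assms in \<open>auto intro: simplex_hom_le simplex_hom_mono\<close>)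

lemma simplex_compose_assoc:
  assumes "\<beta> \<in> simplex_hom k m"
  shows "compose {..k} (compose {..m} \<gamma> \<alpha>) \<beta> = compose {..k} \<gamma> (compose {..k} \<alpha> \<beta>)"
  by (rule compose_assoc[symmetric]) (use assms in \<open>auto intro: simplex_hom_le\<close>)

lemma simplex_compose_id_right: "\<alpha> \<in> simplex_hom m n \<Longrightarrow> compose {..m} \<alpha> (\<lambda>i\<in>{..m}. i) = \<alpha>"
  by (subst simplex_hom_eq_iff) (auto intro: simplex_compose simplex_id simp: compose_eq)

lemma simplex_compose_id_left: "\<alpha> \<in> simplex_hom m n \<Longrightarrow> compose {..m} (\<lambda>i\<in>{..n}. i) \<alpha> = \<alpha>"
  by (subst simplex_hom_eq_iff)
    (auto intro: simplex_compose simplex_id simp: compose_eq dest: simplex_hom_le)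

lemma finite_simplex_hom: "finite (simplex_hom m n)"
  unfolding simplex_hom_def by (rule finite_subset[of _ "{..m} \<rightarrow>\<^sub>E {..n}"]) (auto intro: finite_PiE)

definition vertex :: "nat \<Rightarrow> nat \<Rightarrow> nat" where
  "vertex a = (\<lambda>i\<in>{..0}. a)"

text \<open>The idempotent operator on \<open>[n]\<close> that moves \<open>a + 1\<close> to \<open>a\<close>; for \<open>a < n\<close> it is a degeneracy
  operator followed by a face operator.\<close>

definition fold_edge :: "nat \<Rightarrow> nat \<Rightarrow> nat \<Rightarrow> nat" where
  "fold_edge n a = (\<lambda>i\<in>{..n}. if i = Suc a then a else i)"

lemma vertex_hom: "a \<le> n \<Longrightarrow> vertex a \<in> simplex_hom 0 n"
  unfolding vertex_def by (rule simplex_homI) auto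

lemma fold_edge_hom: "fold_edge n a \<in> simplex_hom n n"
  unfolding fold_edge_def by (rule simplex_homI) auto

lemma vertex_inject: "vertex a = vertex b \<longleftrightarrow> a = b"
  by (auto simp: vertex_def dest: fun_cong[of _ _ 0])

lemma compose_vertex: "i \<le> m \<Longrightarrow> compose {..0} \<alpha> (vertex i) = vertex (\<alpha> i)"
  by (auto simp: vertex_def compose_def fun_eq_iff)

lemma fold_edge_factors:
  assumes "Suc a \<le> n"
  shows "\<exists>\<sigma>\<in>simplex_hom n (n - 1). \<exists>\<delta>\<in>simplex_hom (n - 1) n.
    \<sigma> ` {..n} = {..n - 1} \<and> fold_edge n a = compose {..n} \<delta> \<sigma>"
proof -
  let ?\<sigma> = "\<lambda>i\<in>{..n}. if i \<le> a then i else i - 1"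
  let ?\<delta> = "\<lambda>i\<in>{..n - 1}. if i \<le> a then i else Suc i"
  have "?\<sigma> \<in> simplex_hom n (n - 1)" "?\<delta> \<in> simplex_hom (n - 1) n"
    using assms by (auto intro!: simplex_homI)
  moreover have "j \<in> ?\<sigma> ` {..n}" if "j \<le> n - 1" for j
    by (rule image_eqI[of _ _ "if j \<le> a then j else Suc j"]) (use that assms in auto)
  then have "?\<sigma> ` {..n} = {..n - 1}"
    using assms by auto
  moreover have "fold_edge n a = compose {..n} ?\<delta> ?\<sigma>"
    using assms by (auto simp: fold_edge_def compose_def fun_eq_iff)
  ultimately show ?thesis
    by blast
qed

section \<open>Non-singularity as a Horn condition\<close>

text \<open>For \<open>K\<close> the equality relation the condition says that a simplex whose vertices \<open>a < b\<close> agree is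
  collapsed along its edge from \<open>a\<close> to \<open>a + 1\<close>. A general relation \<open>K\<close> is admitted because this is
  exactly what the quotient by \<open>K\<close> needs in order to be non-singular.\<close>

definition vertex_closed :: "'a sset \<Rightarrow> (nat \<Rightarrow> 'a \<Rightarrow> 'a \<Rightarrow> bool) \<Rightarrow> bool" where
  "vertex_closed X K \<longleftrightarrow>
     (\<forall>n a b. \<forall>x\<in>simp X n. a < b \<longrightarrow> b \<le> n \<longrightarrow>
        K 0 (act X 0 n (vertex a) x) (act X 0 n (vertex b) x) \<longrightarrow>
        K n (act X n n (fold_edge n a) x) x)"

lemma vertex_closedD:
  assumes "vertex_closed X K" "x \<in> simp X n" "a < b" "b \<le> n"
    "K 0 (act X 0 n (vertex a) x) (act X 0 n (vertex b) x)"
  shows "K n (act X n n (fold_edge n a) x) x"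
  using assms unfolding vertex_closed_def by blast

context simplicial_set
begin

text \<open>The existence half of the Eilenberg--Zilber lemma; a degenerate simplex comes from a lower dimension,
  so the descent ends.\<close>

lemma nondegenerate_root:
  "x \<in> simp X n \<Longrightarrow> \<exists>m. \<exists>\<sigma>\<in>simplex_hom n m. \<exists>y\<in>simp X m. \<not> degenerate X m y \<and> x = act X n m \<sigma> y"
proof (induction n arbitrary: x rule: less_induct)
  case (less n)
  show ?case
  proof (cases "degenerate X n x")
    case True
    then obtain m \<sigma> y where *: "m < n" "\<sigma> \<in> simplex_hom n m" "y \<in> simp X m" "x = act X n m \<sigma> y"
      unfolding degenerate_def by blast
    then obtain k \<tau> z where "\<tau> \<in> simplex_hom m k" "z \<in> simp X k" "\<not> degenerate X k z"
      "y = act X m k \<tau> z"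
      using less.IH by blast
    with * have "x = act X n k (compose {..n} \<tau> \<sigma>) z" "compose {..n} \<tau> \<sigma> \<in> simplex_hom n k"
      by (simp_all add: act_comp simplex_compose)
    then show ?thesis
      using \<open>z \<in> simp X k\<close> \<open>\<not> degenerate X k z\<close> by blast
  next
    case False
    then show ?thesis
      using less.prems simplex_id act_id by metis
  qed
qed

lemma act_vertex:
  assumes "\<alpha> \<in> simplex_hom m n" "x \<in> simp X n" "i \<le> m"
  shows "act X 0 m (vertex i) (act X m n \<alpha> x) = act X 0 n (vertex (\<alpha> i)) x"
  using act_comp[OF vertex_hom[OF assms(3)] assms(1,2)] by (simp only: compose_vertex[OF assms(3)])

lemma degenerate_if_folded:
  assumes "x \<in> simp X n" "Suc a \<le> n" "act X n n (fold_edge n a) x = x"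
  shows "degenerate X n x"
proof -
  obtain \<sigma> \<delta> where *: "\<sigma> \<in> simplex_hom n (n - 1)" "\<delta> \<in> simplex_hom (n - 1) n"
    "\<sigma> ` {..n} = {..n - 1}" "fold_edge n a = compose {..n} \<delta> \<sigma>"
    using fold_edge_factors[OF assms(2)] by blast
  then have "x = act X n (n - 1) \<sigma> (act X (n - 1) n \<delta> x)"
    using assms by (simp add: act_comp)
  moreover have "n - 1 < n" using assms(2) by simp
  moreover have "act X (n - 1) n \<delta> x \<in> simp X (n - 1)"
    using act_closed * assms(1) by blast
  ultimately show ?thesis
    unfolding degenerate_def using * by blast
qed

text \<open>If \<open>x = \<sigma>\<^sup>* y\<close> with \<open>y\<close> non-degenerate and \<open>X\<close> is non-singular, then the vertices of \<open>y\<close> are distinct, so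
  equality of the vertices \<open>a < b\<close> of \<open>x\<close> means \<open>\<sigma> a = \<sigma> b\<close>; by monotonicity \<open>\<sigma>\<close> is constant between \<open>a\<close> and
  \<open>b\<close> and hence absorbs the folding of the edge at \<open>a\<close>. Conversely, two distinct operators
  \<open>\<alpha>\<close> and \<open>\<beta>\<close> with \<open>\<alpha>\<^sup>* x = \<beta>\<^sup>* x\<close> differ at some \<open>i\<close>, which makes two distinct vertices of \<open>x\<close> agree; then
  \<open>x\<close> is fixed by a folding operator and is therefore degenerate.\<close>

theorem non_singular_iff: "non_singular X \<longleftrightarrow> vertex_closed X (\<lambda>_. (=))"
proof
  assume ns: "non_singular X"
  show "vertex_closed X (\<lambda>_. (=))"
    unfolding vertex_closed_def
  proof (intro allI ballI impI)
    fix n a b x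
    assume x: "x \<in> simp X n" and ab: "a < b" "b \<le> n"
      and eq: "act X 0 n (vertex a) x = act X 0 n (vertex b) x"
    obtain m \<sigma> y where *: "\<sigma> \<in> simplex_hom n m" "y \<in> simp X m" "\<not> degenerate X m y"
      "x = act X n m \<sigma> y"
      using nondegenerate_root[OF x] by blast
    have inj: "inj_on (\<lambda>\<alpha>. act X 0 m \<alpha> y) (simplex_hom 0 m)"
      using ns * unfolding non_singular_def degreewise_injective_def representing_map_def
      by (fastforce simp: std_simplex_def inj_on_def)
    have "act X 0 m (vertex (\<sigma> a)) y = act X 0 m (vertex (\<sigma> b)) y"
      using eq * ab by (simp add: act_vertex)
    then have "\<sigma> a = \<sigma> b"
      using inj_onD[OF inj] * ab vertex_hom simplex_hom_le vertex_inject
      by (metis le_trans less_imp_le)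
    moreover have "\<sigma> a \<le> \<sigma> (Suc a)" "\<sigma> (Suc a) \<le> \<sigma> b"
      using simplex_hom_mono[OF *(1)] ab by auto
    ultimately have "\<sigma> (Suc a) = \<sigma> a" by simp
    then have "compose {..n} \<sigma> (fold_edge n a) = \<sigma>"
      using *(1)
      by (subst simplex_hom_eq_iff[OF simplex_compose[OF fold_edge_hom *(1)] *(1)])
        (auto simp: compose_def fold_edge_def)
    then show "act X n n (fold_edge n a) x = x"
      using * by (simp add: act_comp[OF fold_edge_hom])
  qed
next
  assume vc: "vertex_closed X (\<lambda>_. (=))"
  show "non_singular X"
    unfolding non_singular_def
  proof (intro allI ballI impI)
    fix n x assume x: "x \<in> simp X n" and nd: "\<not> degenerate X n x"
    have no_edge: "act X 0 n (vertex a) x \<noteq> act X 0 n (vertex b) x" if "a < b" "b \<le> n" for a b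
      using vertex_closedD[OF vc x that] degenerate_if_folded[OF x, of a] that nd by auto
    have "\<alpha> = \<beta>" if *: "\<alpha> \<in> simplex_hom m n" "\<beta> \<in> simplex_hom m n"
      and eq: "act X m n \<alpha> x = act X m n \<beta> x" for m \<alpha> \<beta>
    proof (subst simplex_hom_eq_iff[OF *], intro allI impI)
      fix i assume "i \<le> m"
      then have "act X 0 n (vertex (\<alpha> i)) x = act X 0 n (vertex (\<beta> i)) x"
        using act_vertex[OF _ x, of _ m i] * eq by metis
      then show "\<alpha> i = \<beta> i"
        using no_edge[of "\<alpha> i" "\<beta> i"] no_edge[of "\<beta> i" "\<alpha> i"] simplex_hom_le * \<open>i \<le> m\<close>
        by (metis linorder_neqE_nat)
    qed
    then show "degreewise_injective (representing_map X n x)"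
      unfolding degreewise_injective_def representing_map_def
      by (auto simp: std_simplex_def inj_on_def)
  qed
qed

end

section \<open>The category of non-singular simplicial sets\<close>

lemma ob_nsSet_iff:
  "X \<in> ob (nsSet :: ('u sset, ('u, 'u) smap) cat) \<longleftrightarrow>
     simplicial_set X \<and> (\<forall>n. small TYPE('u) (simp X n)) \<and> vertex_closed X (\<lambda>_. (=))"
  unfolding nsSet_def full_subcategory_def sSet_def
  by (auto simp: simplicial_set.non_singular_iff)

lemma hom_nsSet_iff:
  "f \<in> hom nsSet A B \<longleftrightarrow>
     A \<in> ob nsSet \<and> B \<in> ob nsSet \<and> simplicial_map f \<and> src f = A \<and> tgt f = B"
  unfolding nsSet_def full_subcategory_def sSet_def hom_def
  by (auto simp: simplicial_map_def)

lemma hom_ob: "f \<in> hom nsSet A B \<Longrightarrow> A \<in> ob nsSet" "f \<in> hom nsSet A B \<Longrightarrow> B \<in> ob nsSet"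
  by (simp_all add: hom_nsSet_iff)

lemma app_PiE: "f \<in> hom nsSet A B \<Longrightarrow> app f n \<in> simp A n \<rightarrow>\<^sub>E simp B n"
  by (auto simp only: hom_nsSet_iff simplicial_map_def)

lemma app_closed: "\<lbrakk>f \<in> hom nsSet A B; x \<in> simp A n\<rbrakk> \<Longrightarrow> app f n x \<in> simp B n"
  using app_PiE by blast

lemma app_act:
  "\<lbrakk>f \<in> hom nsSet A B; \<alpha> \<in> simplex_hom m n; x \<in> simp A n\<rbrakk>
    \<Longrightarrow> app f m (act A m n \<alpha> x) = act B m n \<alpha> (app f n x)"
  by (auto simp: hom_nsSet_iff simplicial_map_def)

lemma hom_eqI:
  assumes "f \<in> hom nsSet A B" "g \<in> hom nsSet A B"
    and "\<And>n x. x \<in> simp A n \<Longrightarrow> app f n x = app g n x"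
  shows "f = g"
proof -
  have "app f n = app g n" for n
    by (rule PiE_ext[OF app_PiE[OF assms(1)] app_PiE[OF assms(2)]]) (rule assms(3))
  then show ?thesis
    using assms(1,2) by (cases f; cases g) (auto simp: hom_nsSet_iff)
qed

lemma hom_exists:
  assumes "A \<in> ob nsSet" "B \<in> ob nsSet"
    and "\<And>n x. x \<in> simp A n \<Longrightarrow> g n x \<in> simp B n"
    and "\<And>m n \<alpha> x. \<lbrakk>\<alpha> \<in> simplex_hom m n; x \<in> simp A n\<rbrakk>
      \<Longrightarrow> g m (act A m n \<alpha> x) = act B m n \<alpha> (g n x)"
  obtains f where "f \<in> hom nsSet A B" "\<And>n x. x \<in> simp A n \<Longrightarrow> app f n x = g n x"
proof -
  have "\<lparr>src = A, tgt = B, app = (\<lambda>n. \<lambda>x\<in>simp A n. g n x)\<rparr> \<in> hom nsSet A B"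
    using assms
    by (auto simp: hom_nsSet_iff simplicial_map_def ob_nsSet_iff simplicial_set.act_closed)
  then show thesis
    by (rule that) simp
qed

lemma ob_act_closed:
  "\<lbrakk>A \<in> ob nsSet; \<alpha> \<in> simplex_hom m n; x \<in> simp A n\<rbrakk> \<Longrightarrow> act A m n \<alpha> x \<in> simp A m"
  by (simp add: ob_nsSet_iff simplicial_set.act_closed)

lemma cmp_nsSet:
  "cmp nsSet g f = \<lparr>src = src f, tgt = tgt g, app = (\<lambda>n. compose (simp (src f) n) (app g n) (app f n))\<rparr>"
  unfolding nsSet_def full_subcategory_def sSet_def by simp

lemma app_cmp:
  "\<lbrakk>f \<in> hom nsSet A B; x \<in> simp A n\<rbrakk> \<Longrightarrow> app (cmp nsSet g f) n x = app g n (app f n x)"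
  by (auto simp: cmp_nsSet hom_nsSet_iff compose_eq)

lemma cmp_nsSet_hom:
  assumes "f \<in> hom nsSet A B" "g \<in> hom nsSet B D"
  shows "cmp nsSet g f \<in> hom nsSet A D"
proof -
  have [simp]: "src (cmp nsSet g f) = A" "tgt (cmp nsSet g f) = D"
    using assms by (simp_all add: cmp_nsSet hom_nsSet_iff)
  have "app (cmp nsSet g f) n \<in> simp A n \<rightarrow>\<^sub>E simp D n" for n
  proof (rule PiE_I)
    fix x assume "x \<in> simp A n"
    then show "app (cmp nsSet g f) n x \<in> simp D n"
      using assms by (simp add: app_cmp[OF assms(1)] app_closed)
  next
    fix x assume "x \<notin> simp A n"
    then show "app (cmp nsSet g f) n x = undefined"
      using assms(1) by (simp add: cmp_nsSet compose_def hom_nsSet_iff)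
  qed
  moreover have "app (cmp nsSet g f) m (act A m n \<alpha> x) = act D m n \<alpha> (app (cmp nsSet g f) n x)"
    if "\<alpha> \<in> simplex_hom m n" "x \<in> simp A n" for m n \<alpha> x
    using that app_act[OF assms(1)] app_act[OF assms(2)] app_closed[OF assms(1)]
      ob_act_closed[OF hom_ob(1)[OF assms(1)]]
    by (simp add: app_cmp[OF assms(1)])
  ultimately show ?thesis
    using assms by (simp add: hom_nsSet_iff simplicial_map_def ob_nsSet_iff)
qed

lemma ide_nsSet_hom:
  assumes "A \<in> ob nsSet"
  shows "ide nsSet A \<in> hom nsSet A A"
  using assms unfolding hom_nsSet_iff
  by (auto simp: nsSet_def full_subcategory_def sSet_def simplicial_map_def simplicial_set.act_closed)

lemma app_ide: "x \<in> simp A n \<Longrightarrow> app (ide nsSet A) n x = x"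
  unfolding nsSet_def full_subcategory_def sSet_def by simp

lemma category_nsSet: "category nsSet"
proof
  fix f :: "('a, 'a) smap" assume "f \<in> arr nsSet"
  then have "f \<in> hom nsSet (dm nsSet f) (cd nsSet f)"
    by (simp add: hom_def)
  then show "dm nsSet f \<in> ob nsSet" "cd nsSet f \<in> ob nsSet"
    by (rule hom_ob)+
next
  fix f :: "('a, 'a) smap" and A B assume f: "f \<in> hom nsSet A B"
  have "cmp nsSet f (ide nsSet A) \<in> hom nsSet A B" "cmp nsSet (ide nsSet B) f \<in> hom nsSet A B"
    using f hom_ob ide_nsSet_hom cmp_nsSet_hom by blast+
  then show "cmp nsSet f (ide nsSet A) = f" "cmp nsSet (ide nsSet B) f = f"
    using f ide_nsSet_hom[OF hom_ob(1)[OF f]]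
    by (auto intro!: hom_eqI[OF _ f] simp: app_cmp app_ide app_closed)
next
  fix f g h :: "('a, 'a) smap" and A B D E
  assume *: "f \<in> hom nsSet A B" "g \<in> hom nsSet B D" "h \<in> hom nsSet D E"
  note ** = cmp_nsSet_hom[OF *(1,2)] cmp_nsSet_hom[OF *(2,3)]
  show "cmp nsSet h (cmp nsSet g f) = cmp nsSet (cmp nsSet h g) f"
    by (rule hom_eqI[OF cmp_nsSet_hom[OF **(1) *(3)] cmp_nsSet_hom[OF *(1) **(2)]])
      (simp add: app_cmp[OF *(1)] app_cmp[OF *(2)] app_cmp[OF **(1)] app_closed[OF *(1)])
qed (fact ide_nsSet_hom cmp_nsSet_hom)+

section \<open>Quotients\<close>

definition congruence :: "'a sset \<Rightarrow> (nat \<Rightarrow> 'a \<Rightarrow> 'a \<Rightarrow> bool) \<Rightarrow> bool" where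
  "congruence S K \<longleftrightarrow> (\<forall>n. equivp (K n)) \<and>
     (\<forall>m n. \<forall>\<alpha>\<in>simplex_hom m n. \<forall>x\<in>simp S n. \<forall>y\<in>simp S n.
        K n x y \<longrightarrow> K m (act S m n \<alpha> x) (act S m n \<alpha> y))"

lemma congruence_eq: "congruence S (\<lambda>_. (=))"
  unfolding congruence_def by (simp add: identity_equivp)

definition nonsingular_quotient ::
  "'b sset \<Rightarrow> (nat \<Rightarrow> 'b \<Rightarrow> 'b \<Rightarrow> bool) \<Rightarrow> 'c sset \<Rightarrow> (nat \<Rightarrow> 'b \<Rightarrow> 'c) \<Rightarrow> bool" where
  "nonsingular_quotient S K L \<pi> \<longleftrightarrow>
     (\<forall>n. simp L n = \<pi> n ` simp S n) \<and>
     (\<forall>n. \<forall>x\<in>simp S n. \<forall>y\<in>simp S n. \<pi> n x = \<pi> n y \<longleftrightarrow> K n x y) \<and>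
     (\<forall>m n. \<forall>\<alpha>\<in>simplex_hom m n. \<forall>x\<in>simp S n. \<pi> m (act S m n \<alpha> x) = act L m n \<alpha> (\<pi> n x))"

lemma nonsingular_quotientD:
  assumes "nonsingular_quotient S K L \<pi>"
  shows "simp L n = \<pi> n ` simp S n"
    and "\<lbrakk>x \<in> simp S n; y \<in> simp S n\<rbrakk> \<Longrightarrow> \<pi> n x = \<pi> n y \<longleftrightarrow> K n x y"
    and "\<lbrakk>\<alpha> \<in> simplex_hom m n; x \<in> simp S n\<rbrakk> \<Longrightarrow> \<pi> m (act S m n \<alpha> x) = act L m n \<alpha> (\<pi> n x)"
  using assms unfolding nonsingular_quotient_def by blast+

text \<open>The simplices of \<open>S\<close> may live in any type, as they do for products, disjoint unions and mapping
  spaces; smallness allows the classes of \<open>K\<close> to be named by elements of the universe.\<close>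

lemma nonsingular_quotient_exists:
  fixes S :: "'b sset"
  assumes S: "simplicial_set S" and small: "\<And>n. small TYPE('u) (simp S n)"
    and K: "congruence S K" "vertex_closed S K"
  obtains L :: "'u sset" and \<pi> where "L \<in> ob nsSet" "nonsingular_quotient S K L \<pi>"
proof -
  interpret S: simplicial_set S by (rule S)
  define rep where "rep n x = (SOME y. y \<in> simp S n \<and> K n x y)" for n x
  have equiv: "equivp (K n)" for n
    using K(1) by (simp add: congruence_def)
  have rep: "rep n x \<in> simp S n \<and> K n x (rep n x)" if "x \<in> simp S n" for n x
    unfolding rep_def by (rule someI[of _ x]) (use that equivp_reflp[OF equiv] in auto)
  have rep_eq: "rep n x = rep n y \<longleftrightarrow> K n x y" if "x \<in> simp S n" "y \<in> simp S n" for n x y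
  proof
    assume "rep n x = rep n y"
    then show "K n x y"
      using rep that equivp_symp[OF equiv] equivp_transp[OF equiv] by metis
  next
    assume "K n x y"
    then have "K n x = K n y"
      using equiv by (simp add: equivp_def)
    then show "rep n x = rep n y"
      by (simp add: rep_def)
  qed
  have "\<forall>n. \<exists>e :: 'b \<Rightarrow> 'u. inj_on e (simp S n)"
    using small_inj_into[OF small] by blast
  then obtain e :: "nat \<Rightarrow> 'b \<Rightarrow> 'u" where e: "\<And>n. inj_on (e n) (simp S n)"
    by metis
  define \<pi> where "\<pi> n x = e n (rep n x)" for n x
  have \<pi>_eq: "\<pi> n x = \<pi> n y \<longleftrightarrow> K n x y" if "x \<in> simp S n" "y \<in> simp S n" for n x y
    unfolding \<pi>_def using inj_on_eq_iff[OF e] rep rep_eq that by metis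
  define L where
    "L = \<lparr>simp = \<lambda>n. \<pi> n ` simp S n,
          act = \<lambda>m n \<alpha> z. \<pi> m (act S m n \<alpha> (inv_into (simp S n) (\<pi> n) z))\<rparr>"
  have simp_L: "simp L n = \<pi> n ` simp S n" for n
    by (simp add: L_def)
  have act_L: "act L m n \<alpha> (\<pi> n x) = \<pi> m (act S m n \<alpha> x)"
    if "\<alpha> \<in> simplex_hom m n" "x \<in> simp S n" for m n \<alpha> x
  proof -
    let ?y = "inv_into (simp S n) (\<pi> n) (\<pi> n x)"
    have "?y \<in> simp S n" "\<pi> n ?y = \<pi> n x"
      using that by (auto intro: inv_into_into f_inv_into_f)
    then have "K m (act S m n \<alpha> ?y) (act S m n \<alpha> x)"
      using \<pi>_eq that K(1) by (auto simp: congruence_def)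
    then show ?thesis
      using \<open>?y \<in> simp S n\<close> that by (simp add: L_def \<pi>_eq S.act_closed)
  qed
  have "simplicial_set L"
  proof
    fix m n \<alpha> z assume "\<alpha> \<in> simplex_hom m n" "z \<in> simp L n"
    then show "act L m n \<alpha> z \<in> simp L m"
      by (auto simp: simp_L act_L S.act_closed)
  next
    fix n z assume "z \<in> simp L n"
    then show "act L n n (\<lambda>i\<in>{..n}. i) z = z"
      by (auto simp: simp_L act_L S.act_id simplex_id)
  next
    fix k m n \<beta> \<alpha> z assume "\<beta> \<in> simplex_hom k m" "\<alpha> \<in> simplex_hom m n" "z \<in> simp L n"
    then show "act L k m \<beta> (act L m n \<alpha> z) = act L k n (compose {..k} \<alpha> \<beta>) z"
      by (auto simp: simp_L act_L S.act_comp S.act_closed simplex_compose)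
  qed
  moreover have "small TYPE('u) (simp L n)" for n
    unfolding simp_L by (rule small_image[OF small])
  moreover have "vertex_closed L (\<lambda>_. (=))"
    unfolding vertex_closed_def
  proof (intro allI ballI impI)
    fix n a b z
    assume z: "z \<in> simp L n" and ab: "a < b" "b \<le> n"
      and eq: "act L 0 n (vertex a) z = act L 0 n (vertex b) z"
    obtain x where x: "x \<in> simp S n" "z = \<pi> n x"
      using z by (auto simp: simp_L)
    then have "K 0 (act S 0 n (vertex a) x) (act S 0 n (vertex b) x)"
      using eq ab by (simp add: act_L vertex_hom \<pi>_eq S.act_closed)
    then have "K n (act S n n (fold_edge n a) x) x"
      using vertex_closedD[OF K(2) x(1)] ab by blast
    then show "act L n n (fold_edge n a) z = z"
      using x by (simp add: act_L fold_edge_hom \<pi>_eq S.act_closed)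
  qed
  ultimately have "L \<in> ob nsSet"
    by (simp add: ob_nsSet_iff)
  moreover have "nonsingular_quotient S K L \<pi>"
    by (simp add: nonsingular_quotient_def simp_L \<pi>_eq act_L)
  ultimately show thesis
    by (rule that)
qed

text \<open>A pair of mutually inverse simplicial maps between simplicial sets over different types, given
  only by their values on simplices.\<close>

definition sset_iso ::
  "'b sset \<Rightarrow> 'c sset \<Rightarrow> (nat \<Rightarrow> 'b \<Rightarrow> 'c) \<Rightarrow> (nat \<Rightarrow> 'c \<Rightarrow> 'b) \<Rightarrow> bool" where
  "sset_iso S L \<pi> \<delta> \<longleftrightarrow>
     (\<forall>n. \<forall>x\<in>simp S n. \<pi> n x \<in> simp L n \<and> \<delta> n (\<pi> n x) = x) \<and>
     (\<forall>n. \<forall>z\<in>simp L n. \<delta> n z \<in> simp S n \<and> \<pi> n (\<delta> n z) = z) \<and>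
     (\<forall>m n. \<forall>\<alpha>\<in>simplex_hom m n.
        (\<forall>x\<in>simp S n. \<pi> m (act S m n \<alpha> x) = act L m n \<alpha> (\<pi> n x)) \<and>
        (\<forall>z\<in>simp L n. \<delta> m (act L m n \<alpha> z) = act S m n \<alpha> (\<delta> n z)))"

lemma sset_isoD:
  assumes "sset_iso S L \<pi> \<delta>"
  shows "x \<in> simp S n \<Longrightarrow> \<pi> n x \<in> simp L n"
    and "x \<in> simp S n \<Longrightarrow> \<delta> n (\<pi> n x) = x"
    and "z \<in> simp L n \<Longrightarrow> \<delta> n z \<in> simp S n"
    and "z \<in> simp L n \<Longrightarrow> \<pi> n (\<delta> n z) = z"
    and "\<lbrakk>\<alpha> \<in> simplex_hom m n; x \<in> simp S n\<rbrakk> \<Longrightarrow> \<pi> m (act S m n \<alpha> x) = act L m n \<alpha> (\<pi> n x)"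
    and "\<lbrakk>\<alpha> \<in> simplex_hom m n; z \<in> simp L n\<rbrakk> \<Longrightarrow> \<delta> m (act L m n \<alpha> z) = act S m n \<alpha> (\<delta> n z)"
  using assms unfolding sset_iso_def by simp_all

lemma nonsingular_copy:
  fixes S :: "'b sset"
  assumes S: "simplicial_set S" and small: "\<And>n. small TYPE('u) (simp S n)"
    and S': "vertex_closed S (\<lambda>_. (=))"
  obtains L :: "'u sset" and \<pi> \<delta> where "L \<in> ob nsSet" "sset_iso S L \<pi> \<delta>"
proof -
  obtain L :: "'u sset" and \<pi> where L_ob: "L \<in> ob nsSet"
    and \<pi>: "nonsingular_quotient S (\<lambda>_. (=)) L \<pi>"
    by (rule nonsingular_quotient_exists[OF S small congruence_eq S'])
  note L = nonsingular_quotientD[OF \<pi>]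
  have inj: "inj_on (\<pi> n) (simp S n)" for n
    using L(2) by (auto simp: inj_on_def)
  have "sset_iso S L \<pi> (\<lambda>n. inv_into (simp S n) (\<pi> n))"
    using inj simplicial_set.act_closed[OF S]
    by (auto simp: sset_iso_def L(1) L(3)[symmetric] inv_into_into f_inv_into_f)
  then show thesis
    using that L_ob by blast
qed

section \<open>Limits\<close>

definition compatible_families ::
  "('j, 'k) cat \<Rightarrow> ('j \<Rightarrow> 'u sset) \<Rightarrow> ('k \<Rightarrow> ('u, 'u) smap) \<Rightarrow> ('j \<Rightarrow> 'u) sset" where
  "compatible_families J Fo Fa = \<lparr>
     simp = (\<lambda>n. {s \<in> \<Pi>\<^sub>E j\<in>ob J. simp (Fo j) n.
        \<forall>u\<in>arr J. app (Fa u) n (s (dm J u)) = s (cd J u)}),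
     act = (\<lambda>m n \<alpha> s. \<lambda>j\<in>ob J. act (Fo j) m n \<alpha> (s j))\<rparr>"

text \<open>The limit is the simplicial set of compatible families; it is non-singular because both sides of
  each Horn clause are equations between families, which hold if they hold in every component.\<close>

lemma has_limits_nsSet:
  fixes J :: "('j, 'k) cat"
  assumes U: "universe TYPE('u)" and J: "small_category TYPE('u) J"
  shows "has_limits_of_shape J (nsSet :: ('u sset, ('u, 'u) smap) cat)"
  unfolding has_limits_of_shape_def
proof (intro allI impI)
  fix Fo :: "'j \<Rightarrow> 'u sset" and Fa :: "'k \<Rightarrow> ('u, 'u) smap"
  assume "diagram J nsSet Fo Fa"
  then interpret D: diagram J nsSet Fo Fa .
  have Fo: "simplicial_set (Fo j)" if "j \<in> ob J" for j
    using D.on_ob[OF that] by (simp add: ob_nsSet_iff)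
  have Fa: "dm J u \<in> ob J" "cd J u \<in> ob J" "Fa u \<in> hom nsSet (Fo (dm J u)) (Fo (cd J u))"
    if "u \<in> arr J" for u
    using that D.J.dm_ob D.J.cd_ob D.on_hom by (auto simp: hom_def)
  let ?S = "compatible_families J Fo Fa"
  have S_iff: "s \<in> simp ?S n \<longleftrightarrow> s \<in> (\<Pi>\<^sub>E j\<in>ob J. simp (Fo j) n) \<and>
      (\<forall>u\<in>arr J. app (Fa u) n (s (dm J u)) = s (cd J u))" for s n
    by (simp add: compatible_families_def)
  have act_S: "act ?S m n \<alpha> s = (\<lambda>j\<in>ob J. act (Fo j) m n \<alpha> (s j))" for m n \<alpha> s
    by (simp add: compatible_families_def)
  have S_mem: "s j \<in> simp (Fo j) n" if "s \<in> simp ?S n" "j \<in> ob J" for s n j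
    using that by (auto simp: S_iff)
  have S_eqI: "s = t" if "s \<in> simp ?S n" "t \<in> simp ?S n" "\<And>j. j \<in> ob J \<Longrightarrow> s j = t j" for s t n
    using that by (auto simp: S_iff intro: PiE_ext)
  have act_closed: "act ?S m n \<alpha> s \<in> simp ?S m" if "\<alpha> \<in> simplex_hom m n" "s \<in> simp ?S n" for m n \<alpha> s
    unfolding S_iff
  proof (intro conjI ballI)
    show "act ?S m n \<alpha> s \<in> (\<Pi>\<^sub>E j\<in>ob J. simp (Fo j) m)"
      using that by (auto simp: act_S S_mem simplicial_set.act_closed[OF Fo])
    fix u assume u: "u \<in> arr J"
    show "app (Fa u) m (act ?S m n \<alpha> s (dm J u)) = act ?S m n \<alpha> s (cd J u)"
      using that Fa[OF u] app_act[OF Fa(3)[OF u] that(1) S_mem[OF that(2)]] u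
      by (simp add: act_S S_iff)
  qed
  have "simplicial_set ?S"
  proof
    fix n s assume "s \<in> simp ?S n"
    then show "act ?S n n (\<lambda>i\<in>{..n}. i) s = s"
      by (intro S_eqI[OF act_closed[OF simplex_id]]) (auto simp: act_S S_mem simplicial_set.act_id[OF Fo])
  next
    fix k m n \<beta> \<alpha> s assume "\<beta> \<in> simplex_hom k m" "\<alpha> \<in> simplex_hom m n" "s \<in> simp ?S n"
    then show "act ?S k m \<beta> (act ?S m n \<alpha> s) = act ?S k n (compose {..k} \<alpha> \<beta>) s"
      by (intro S_eqI[of _ k] act_closed simplex_compose) (auto simp: act_S S_mem simplicial_set.act_comp[OF Fo])
  qed (fact act_closed)
  moreover have "small TYPE('u) (simp ?S n)" for n
  proof (rule small_subset)
    show "small TYPE('u) (\<Pi>\<^sub>E j\<in>ob J. simp (Fo j) n)"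
      using J D.on_ob by (intro small_PiE U) (auto simp: small_category_def ob_nsSet_iff)
  qed (auto simp: S_iff)
  moreover have "vertex_closed ?S (\<lambda>_. (=))"
    unfolding vertex_closed_def
  proof (intro allI ballI impI)
    fix n a b s
    assume s: "s \<in> simp ?S n" and ab: "a < b" "b \<le> n"
      and eq: "act ?S 0 n (vertex a) s = act ?S 0 n (vertex b) s"
    show "act ?S n n (fold_edge n a) s = s"
    proof (rule S_eqI[OF act_closed[OF fold_edge_hom s] s])
      fix j assume j: "j \<in> ob J"
      then have "act (Fo j) 0 n (vertex a) (s j) = act (Fo j) 0 n (vertex b) (s j)"
        using fun_cong[OF eq, of j] by (simp add: act_S)
      then show "act ?S n n (fold_edge n a) s j = s j"
        using D.on_ob[OF j] vertex_closedD[of "Fo j" "\<lambda>_. (=)", OF _ S_mem[OF s j] ab] j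
        by (simp add: act_S ob_nsSet_iff)
    qed
  qed
  ultimately obtain L :: "'u sset" and \<pi> \<delta> where L_ob: "L \<in> ob nsSet" and iso: "sset_iso ?S L \<pi> \<delta>"
    by (rule nonsingular_copy)
  note L = L_ob sset_isoD[OF iso]
  have "\<exists>f. f \<in> hom nsSet L (Fo j) \<and> (\<forall>n. \<forall>z\<in>simp L n. app f n z = \<delta> n z j)"
    if "j \<in> ob J" for j
    by (rule hom_exists[OF L(1) D.on_ob[OF that], of "\<lambda>n z. \<delta> n z j"])
      (auto simp: L(4,7) S_mem act_S that)
  then obtain p where p: "\<And>j. j \<in> ob J \<Longrightarrow> p j \<in> hom nsSet L (Fo j)"
    "\<And>j n z. \<lbrakk>j \<in> ob J; z \<in> simp L n\<rbrakk> \<Longrightarrow> app (p j) n z = \<delta> n z j"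
    by metis
  have "is_limit J nsSet Fo Fa L p"
    unfolding is_limit_def
  proof (intro conjI allI impI)
    show "is_cone J nsSet Fo Fa L p"
      unfolding is_cone_def
    proof (intro conjI ballI)
      fix u assume u: "u \<in> arr J"
      show "cmp nsSet (Fa u) (p (dm J u)) = p (cd J u)"
      proof (rule hom_eqI[OF cmp_nsSet_hom[OF p(1)[OF Fa(1)[OF u]] Fa(3)[OF u]] p(1)[OF Fa(2)[OF u]]])
        fix n z assume z: "z \<in> simp L n"
        then have "app (Fa u) n (\<delta> n z (dm J u)) = \<delta> n z (cd J u)"
          using L(4) u by (auto simp: S_iff)
        then show "app (cmp nsSet (Fa u) (p (dm J u))) n z = app (p (cd J u)) n z"
          using z u Fa p by (simp add: app_cmp[OF p(1)[OF Fa(1)[OF u]]])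
      qed
    qed (use L p in auto)
  next
    fix M q assume "is_cone J nsSet Fo Fa M q"
    then have M: "M \<in> ob nsSet" and q: "\<And>j. j \<in> ob J \<Longrightarrow> q j \<in> hom nsSet M (Fo j)"
      and q_cone: "\<And>u. u \<in> arr J \<Longrightarrow> cmp nsSet (Fa u) (q (dm J u)) = q (cd J u)"
      by (auto simp: is_cone_def)
    let ?g = "\<lambda>n x. \<lambda>j\<in>ob J. app (q j) n x"
    have g: "?g n x \<in> simp ?S n" if x: "x \<in> simp M n" for n x
      unfolding S_iff
    proof (intro conjI ballI)
      show "?g n x \<in> (\<Pi>\<^sub>E j\<in>ob J. simp (Fo j) n)"
        using app_closed[OF q x] by simp
      fix u assume u: "u \<in> arr J"
      show "app (Fa u) n (?g n x (dm J u)) = ?g n x (cd J u)"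
        using app_cmp[OF q[OF Fa(1)[OF u]] x, of "Fa u"] Fa[OF u] q_cone[OF u] by simp
    qed
    have g_act: "?g m (act M m n \<alpha> x) = act ?S m n \<alpha> (?g n x)"
      if "\<alpha> \<in> simplex_hom m n" "x \<in> simp M n" for m n \<alpha> x
      unfolding act_S using app_act[OF q that] by (intro restrict_ext) simp
    obtain h where h: "h \<in> hom nsSet M L" "\<And>n x. x \<in> simp M n \<Longrightarrow> app h n x = \<pi> n (?g n x)"
      by (rule hom_exists[OF M L(1), of "\<lambda>n x. \<pi> n (?g n x)"]) (simp_all add: L(2,6) g g_act)
    show "\<exists>!h. h \<in> hom nsSet M L \<and> (\<forall>j\<in>ob J. cmp nsSet (p j) h = q j)"
    proof (intro ex1I conjI ballI)
      show "h \<in> hom nsSet M L" by (rule h)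
      fix j assume j: "j \<in> ob J"
      show "cmp nsSet (p j) h = q j"
      proof (rule hom_eqI[OF cmp_nsSet_hom[OF h(1) p(1)[OF j]] q[OF j]])
        fix n x assume "x \<in> simp M n"
        then show "app (cmp nsSet (p j) h) n x = app (q j) n x"
          using j by (simp add: app_cmp[OF h(1)] h(2) p(2) L(2,3) g)
      qed
    next
      fix h' assume h': "h' \<in> hom nsSet M L \<and> (\<forall>j\<in>ob J. cmp nsSet (p j) h' = q j)"
      show "h' = h"
      proof (rule hom_eqI[OF conjunct1[OF h'] h(1)])
        fix n x assume x: "x \<in> simp M n"
        have L_x: "app h' n x \<in> simp L n"
          by (rule app_closed[OF conjunct1[OF h'] x])
        have "\<delta> n (app h' n x) = ?g n x"
        proof (rule S_eqI[OF L(4)[OF L_x] g[OF x]])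
          fix j assume j: "j \<in> ob J"
          then have "app (q j) n x = app (p j) n (app h' n x)"
            using h' app_cmp[OF conjunct1[OF h'] x, of "p j"] by simp
          then show "\<delta> n (app h' n x) j = ?g n x j"
            using p(2)[OF j L_x] j by simp
        qed
        then show "app h' n x = app h n x"
          using L(5)[OF L_x] h(2)[OF x] by simp
      qed
    qed
  qed
  then show "\<exists>L p. is_limit J nsSet Fo Fa L p"
    by blast
qed

section \<open>Finite products\<close>

lemma terminal_nsSet:
  assumes U: "universe TYPE('u)"
  shows "\<exists>T. is_terminal (nsSet :: ('u sset, ('u, 'u) smap) cat) T"
proof -
  let ?T = "\<lparr>simp = \<lambda>_. {undefined}, act = \<lambda>_ _ _ _. undefined\<rparr> :: 'u sset"
  have T: "?T \<in> ob nsSet"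
    using U by (auto simp: ob_nsSet_iff simplicial_set_def vertex_closed_def small_finite)
  have "\<exists>!f. f \<in> hom nsSet A ?T" if A: "A \<in> ob nsSet" for A
  proof -
    obtain f where "f \<in> hom nsSet A ?T"
      by (rule hom_exists[OF A T, of "\<lambda>_ _. undefined"]) auto
    moreover have "g = f" if "g \<in> hom nsSet A ?T" "f \<in> hom nsSet A ?T" for f g
      by (rule hom_eqI[OF that]) (use app_closed[OF that(1)] app_closed[OF that(2)] in simp)
    ultimately show ?thesis
      by blast
  qed
  then show ?thesis
    using T unfolding is_terminal_def by blast
qed

definition binary_product :: "'a sset \<Rightarrow> 'b sset \<Rightarrow> ('a \<times> 'b) sset" where
  "binary_product A B = \<lparr>
     simp = (\<lambda>n. simp A n \<times> simp B n),
     act = (\<lambda>m n \<alpha> (x, y). (act A m n \<alpha> x, act B m n \<alpha> y))\<rparr>"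

text \<open>The concrete form of a binary product, in which pairs of simplices can be formed. The universal
  property of an exponential speaks of arbitrary products; the two lemmas
  \<open>levelwise_product_is_product\<close> and \<open>product_levelwise\<close> reduce them to this form.\<close>

definition levelwise_product ::
  "'u sset \<Rightarrow> 'u sset \<Rightarrow> 'u sset \<Rightarrow> ('u, 'u) smap \<Rightarrow> ('u, 'u) smap \<Rightarrow> bool" where
  "levelwise_product A B P p q \<longleftrightarrow>
     p \<in> hom nsSet P A \<and> q \<in> hom nsSet P B \<and>
     (\<forall>n. bij_betw (\<lambda>z. (app p n z, app q n z)) (simp P n) (simp A n \<times> simp B n))"

lemma levelwise_product_exists:
  fixes A B :: "'u sset"
  assumes U: "universe TYPE('u)" and A: "A \<in> ob nsSet" and B: "B \<in> ob nsSet"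
  shows "\<exists>P p q. levelwise_product A B P p q"
proof -
  interpret A: simplicial_set A using A by (simp add: ob_nsSet_iff)
  interpret B: simplicial_set B using B by (simp add: ob_nsSet_iff)
  let ?S = "binary_product A B"
  have simp_S: "simp ?S n = simp A n \<times> simp B n" for n
    by (simp add: binary_product_def)
  have act_S: "act ?S m n \<alpha> z = (act A m n \<alpha> (fst z), act B m n \<alpha> (snd z))" for m n \<alpha> z
    by (simp add: binary_product_def case_prod_beta)
  have "simplicial_set ?S"
    by unfold_locales
      (auto simp: simp_S act_S A.act_closed B.act_closed A.act_id B.act_id A.act_comp B.act_comp)
  moreover have "small TYPE('u) (simp ?S n)" for n
    unfolding simp_S using A B by (intro small_Sigma U) (simp_all add: ob_nsSet_iff)
  moreover have "vertex_closed ?S (\<lambda>_. (=))"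
    unfolding vertex_closed_def
  proof (intro allI ballI impI)
    fix n a b z
    assume "z \<in> simp ?S n" "a < b" "b \<le> n"
      "act ?S 0 n (vertex a) z = act ?S 0 n (vertex b) z"
    then show "act ?S n n (fold_edge n a) z = z"
      using vertex_closedD[of A "\<lambda>_. (=)" "fst z" n a b] vertex_closedD[of B "\<lambda>_. (=)" "snd z" n a b] A B
      by (auto simp: simp_S act_S ob_nsSet_iff)
  qed
  ultimately obtain P :: "'u sset" and \<pi> \<delta> where P_ob: "P \<in> ob nsSet" and iso: "sset_iso ?S P \<pi> \<delta>"
    by (rule nonsingular_copy)
  note P = P_ob sset_isoD[OF iso]
  have \<delta>: "fst (\<delta> n z) \<in> simp A n" "snd (\<delta> n z) \<in> simp B n" if "z \<in> simp P n" for n z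
    using P(4)[OF that] by (auto simp: simp_S)
  obtain p where p: "p \<in> hom nsSet P A" "\<And>n z. z \<in> simp P n \<Longrightarrow> app p n z = fst (\<delta> n z)"
    by (rule hom_exists[OF P(1) A, of "\<lambda>n z. fst (\<delta> n z)"]) (simp_all add: \<delta> P(7) act_S)
  obtain q where q: "q \<in> hom nsSet P B" "\<And>n z. z \<in> simp P n \<Longrightarrow> app q n z = snd (\<delta> n z)"
    by (rule hom_exists[OF P(1) B, of "\<lambda>n z. snd (\<delta> n z)"]) (simp_all add: \<delta> P(7) act_S)
  have "bij_betw (\<lambda>z. (app p n z, app q n z)) (simp P n) (simp A n \<times> simp B n)" for n
  proof (rule bij_betw_byWitness[of _ "\<pi> n"])
    show "\<forall>s\<in>simp A n \<times> simp B n. (app p n (\<pi> n s), app q n (\<pi> n s)) = s"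
      using P(2,3) p(2) q(2) by (simp add: simp_S)
    show "\<forall>z\<in>simp P n. \<pi> n (app p n z, app q n z) = z"
      using P(5) by (simp add: p(2) q(2))
    show "\<pi> n ` (simp A n \<times> simp B n) \<subseteq> simp P n"
      using P(2) by (auto simp: simp_S)
    show "(\<lambda>z. (app p n z, app q n z)) ` simp P n \<subseteq> simp A n \<times> simp B n"
      using app_closed[OF p(1)] app_closed[OF q(1)] by auto
  qed
  then show ?thesis
    using p(1) q(1) unfolding levelwise_product_def by blast
qed

lemma levelwise_product_is_product:
  assumes P: "levelwise_product A B P p q"
  shows "is_product nsSet A B P p q"
proof -
  let ?pq = "\<lambda>n z. (app p n z, app q n z)"
  have p: "p \<in> hom nsSet P A" and q: "q \<in> hom nsSet P B"
    and bij: "\<And>n. bij_betw (?pq n) (simp P n) (simp A n \<times> simp B n)"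
    using P by (auto simp: levelwise_product_def)
  have P_ob: "P \<in> ob nsSet"
    using hom_ob(1)[OF p] .
  have eqI: "z = w" if "z \<in> simp P n" "w \<in> simp P n" "app p n z = app p n w" "app q n z = app q n w"
    for n z w
    by (rule inj_onD[OF bij_betw_imp_inj_on[OF bij[of n]]]) (simp_all add: that)
  have "\<exists>!h. h \<in> hom nsSet X P \<and> cmp nsSet p h = f \<and> cmp nsSet q h = g"
    if f: "f \<in> hom nsSet X A" and g: "g \<in> hom nsSet X B" for X f g
  proof -
    have X: "X \<in> ob nsSet"
      using hom_ob(1)[OF f] .
    note X' = ob_act_closed[OF X] and P' = ob_act_closed[OF P_ob]
    define k where "k n x = inv_into (simp P n) (?pq n) (app f n x, app g n x)" for n x
    have k: "k n x \<in> simp P n" "app p n (k n x) = app f n x" "app q n (k n x) = app g n x"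
      if "x \<in> simp X n" for n x
    proof -
      have "(app f n x, app g n x) \<in> ?pq n ` simp P n"
        using bij_betw_imp_surj_on[OF bij] app_closed[OF f that] app_closed[OF g that] by simp
      from inv_into_into[OF this] f_inv_into_f[OF this]
      show "k n x \<in> simp P n" "app p n (k n x) = app f n x" "app q n (k n x) = app g n x"
        by (simp_all add: k_def)
    qed
    obtain h where h: "h \<in> hom nsSet X P" "\<And>n x. x \<in> simp X n \<Longrightarrow> app h n x = k n x"
    proof (rule hom_exists[OF X P_ob, of k])
      fix m n \<alpha> x assume *: "\<alpha> \<in> simplex_hom m n" "x \<in> simp X n"
      show "k m (act X m n \<alpha> x) = act P m n \<alpha> (k n x)"
        by (rule eqI[of _ m]) (simp_all add: * k X' P' app_act[OF p] app_act[OF q] app_act[OF f] app_act[OF g])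
    qed (simp add: k, rule that)
    show ?thesis
    proof (rule ex1I[of _ h])
      have "cmp nsSet p h = f"
        by (rule hom_eqI[OF cmp_nsSet_hom[OF h(1) p] f]) (simp add: app_cmp[OF h(1)] h(2) k)
      moreover have "cmp nsSet q h = g"
        by (rule hom_eqI[OF cmp_nsSet_hom[OF h(1) q] g]) (simp add: app_cmp[OF h(1)] h(2) k)
      ultimately show "h \<in> hom nsSet X P \<and> cmp nsSet p h = f \<and> cmp nsSet q h = g"
        using h(1) by simp
    next
      fix h' assume h': "h' \<in> hom nsSet X P \<and> cmp nsSet p h' = f \<and> cmp nsSet q h' = g"
      then have hom: "h' \<in> hom nsSet X P" by blast
      show "h' = h"
      proof (rule hom_eqI[OF hom h(1)])
        fix n x assume x: "x \<in> simp X n"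
        show "app h' n x = app h n x"
          by (rule eqI[of _ n])
            (simp_all add: h(2) k x app_closed[OF hom x] h' app_cmp[OF hom x, symmetric])
      qed
    qed
  qed
  then show ?thesis
    using P_ob p q by (simp add: is_product_def)
qed

lemma product_factor:
  assumes "is_product nsSet A B P p q" "f \<in> hom nsSet X A" "g \<in> hom nsSet X B"
  shows "\<exists>!h. h \<in> hom nsSet X P \<and> cmp nsSet p h = f \<and> cmp nsSet q h = g"
  using assms hom_ob(1)[OF assms(2)] unfolding is_product_def by simp

text \<open>Any product is isomorphic to a concrete one over the projections, so its simplices are pairs too.\<close>

lemma product_levelwise:
  fixes A B Q :: "'u sset"
  assumes U: "universe TYPE('u)" and A: "A \<in> ob nsSet" and B: "B \<in> ob nsSet"
    and Q: "is_product nsSet A B Q r s"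
  shows "levelwise_product A B Q r s"
proof -
  obtain P p q where P: "levelwise_product A B P p q"
    using levelwise_product_exists[OF U A B] by blast
  then have pP: "p \<in> hom nsSet P A" "q \<in> hom nsSet P B"
    and bij: "\<And>n. bij_betw (\<lambda>z. (app p n z, app q n z)) (simp P n) (simp A n \<times> simp B n)"
    by (auto simp: levelwise_product_def)
  have P': "is_product nsSet A B P p q"
    by (rule levelwise_product_is_product[OF P])
  have rs: "Q \<in> ob nsSet" "r \<in> hom nsSet Q A" "s \<in> hom nsSet Q B"
    using Q by (auto simp: is_product_def)
  obtain h where h: "h \<in> hom nsSet Q P" "cmp nsSet p h = r" "cmp nsSet q h = s"
    using product_factor[OF P' rs(2,3)] by blast
  obtain k where k: "k \<in> hom nsSet P Q" "cmp nsSet r k = p" "cmp nsSet s k = q"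
    using product_factor[OF Q pP] by blast
  have h_app: "app p n (app h n z) = app r n z" "app q n (app h n z) = app s n z"
    if "z \<in> simp Q n" for n z
    using app_cmp[OF h(1) that, of p] app_cmp[OF h(1) that, of q] by (simp_all add: h)
  have k_app: "app r n (app k n z) = app p n z" "app s n (app k n z) = app q n z"
    if "z \<in> simp P n" for n z
    using app_cmp[OF k(1) that, of r] app_cmp[OF k(1) that, of s] by (simp_all add: k)
  \<comment> \<open>The composite endomorphism of \<open>Q\<close> is the identity because \<open>Q\<close> is a product.\<close>
  have kh: "cmp nsSet k h = ide nsSet Q"
  proof -
    have "\<exists>!e. e \<in> hom nsSet Q Q \<and> cmp nsSet r e = r \<and> cmp nsSet s e = s"
      by (rule product_factor[OF Q rs(2,3)])
    moreover have "cmp nsSet k h \<in> hom nsSet Q Q"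
      using cmp_nsSet_hom[OF h(1) k(1)] .
    moreover have "cmp nsSet r (cmp nsSet k h) = r" "cmp nsSet s (cmp nsSet k h) = s"
      using category.cmp_assoc[OF category_nsSet h(1) k(1) rs(2)]
        category.cmp_assoc[OF category_nsSet h(1) k(1) rs(3)] by (simp_all add: h k)
    moreover have "ide nsSet Q \<in> hom nsSet Q Q" "cmp nsSet r (ide nsSet Q) = r"
      "cmp nsSet s (ide nsSet Q) = s"
      using ide_nsSet_hom[OF rs(1)] category.ide_right[OF category_nsSet rs(2)]
        category.ide_right[OF category_nsSet rs(3)] by simp_all
    ultimately show ?thesis
      by blast
  qed
  have "bij_betw (\<lambda>z. (app r n z, app s n z)) (simp Q n) (simp A n \<times> simp B n)" for n
  proof -
    have kh_app: "app k n (app h n z) = z" if "z \<in> simp Q n" for z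
      using app_cmp[OF h(1) that, of k] kh app_ide[OF that] by simp
    have "bij_betw (app h n) (simp Q n) (simp P n)"
    proof (rule bij_betw_byWitness[of _ "app k n"])
      show "\<forall>z\<in>simp P n. app h n (app k n z) = z"
      proof
        fix z assume z: "z \<in> simp P n"
        have "app k n z \<in> simp Q n" "app h n (app k n z) \<in> simp P n"
          using app_closed[OF k(1) z] app_closed[OF h(1)] by simp_all
        then show "app h n (app k n z) = z"
          using inj_onD[OF bij_betw_imp_inj_on[OF bij[of n]]] z by (simp add: h_app k_app)
      qed
    qed (use kh_app app_closed[OF h(1)] app_closed[OF k(1)] in auto)
    from bij_betw_trans[OF this bij[of n]] show ?thesis
      by (rule bij_betw_cong[THEN iffD1, rotated]) (simp add: h_app)
  qed
  then show ?thesis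
    using rs unfolding levelwise_product_def by blast
qed

section \<open>Colimits\<close>

definition coproduct :: "'j set \<Rightarrow> ('j \<Rightarrow> 'u sset) \<Rightarrow> ('j \<times> 'u) sset" where
  "coproduct I F = \<lparr>
     simp = (\<lambda>n. SIGMA j:I. simp (F j) n),
     act = (\<lambda>m n \<alpha> (j, x). (j, act (F j) m n \<alpha> x))\<rparr>"

text \<open>The least congruence that contains \<open>R\<close> and satisfies the Horn condition. It may identify more
  than the simplicial quotient by \<open>R\<close>: dividing by it also applies the reflection from
  simplicial sets to non-singular ones.\<close>

inductive collapse :: "'a sset \<Rightarrow> (nat \<Rightarrow> 'a \<Rightarrow> 'a \<Rightarrow> bool) \<Rightarrow> nat \<Rightarrow> 'a \<Rightarrow> 'a \<Rightarrow> bool"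
  for S R where
    gen: "R n x y \<Longrightarrow> collapse S R n x y"
  | refl: "collapse S R n x x"
  | sym: "collapse S R n x y \<Longrightarrow> collapse S R n y x"
  | trans: "collapse S R n x y \<Longrightarrow> collapse S R n y z \<Longrightarrow> collapse S R n x z"
  | act: "collapse S R n x y \<Longrightarrow> \<alpha> \<in> simplex_hom m n \<Longrightarrow> x \<in> simp S n \<Longrightarrow> y \<in> simp S n
      \<Longrightarrow> collapse S R m (act S m n \<alpha> x) (act S m n \<alpha> y)"
  | fold: "x \<in> simp S n \<Longrightarrow> a < b \<Longrightarrow> b \<le> n
      \<Longrightarrow> collapse S R 0 (act S 0 n (vertex a) x) (act S 0 n (vertex b) x)
      \<Longrightarrow> collapse S R n (act S n n (fold_edge n a) x) x"

lemma collapse_congruence: "congruence S (collapse S R)"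
proof -
  have "equivp (collapse S R n)" for n
    by (intro equivpI reflpI sympI transpI) (fact collapse.refl collapse.sym collapse.trans)+
  then show ?thesis
    unfolding congruence_def by (simp add: collapse.act)
qed

lemma collapse_vertex_closed: "vertex_closed S (collapse S R)"
  unfolding vertex_closed_def by (simp add: collapse.fold)

text \<open>A simplicial map into a non-singular \<open>M\<close> has a kernel that satisfies the Horn condition, so it
  identifies whatever \<open>collapse\<close> identifies as soon as it respects the generators.\<close>

lemma collapse_least:
  assumes S: "simplicial_set S" and M: "vertex_closed M (\<lambda>_. (=))"
    and R: "\<And>n x y. R n x y \<Longrightarrow> x \<in> simp S n \<and> y \<in> simp S n \<and> g n x = g n y"
    and g: "\<And>n x. x \<in> simp S n \<Longrightarrow> g n x \<in> simp M n"
    and g_act: "\<And>m n \<alpha> x. \<lbrakk>\<alpha> \<in> simplex_hom m n; x \<in> simp S n\<rbrakk>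
      \<Longrightarrow> g m (act S m n \<alpha> x) = act M m n \<alpha> (g n x)"
    and xy: "collapse S R n x y"
  shows "g n x = g n y"
  using xy
proof (induction rule: collapse.induct)
  case (fold x n a b)
  then show ?case
    using vertex_closedD[OF M g[OF fold(1)] fold(2,3)]
    by (simp add: g_act vertex_hom fold_edge_hom)
qed (auto simp: R g_act)

text \<open>The colimit is the disjoint union of the diagram, divided by the least admissible congruence that
  identifies each simplex with its images under the maps of the diagram.\<close>

lemma has_colimits_nsSet:
  fixes J :: "('j, 'k) cat"
  assumes U: "universe TYPE('u)" and J: "small_category TYPE('u) J"
  shows "has_colimits_of_shape J (nsSet :: ('u sset, ('u, 'u) smap) cat)"
  unfolding has_colimits_of_shape_def
proof (intro allI impI)
  fix Fo :: "'j \<Rightarrow> 'u sset" and Fa :: "'k \<Rightarrow> ('u, 'u) smap"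
  assume "diagram J nsSet Fo Fa"
  then interpret D: diagram J nsSet Fo Fa .
  have Fo: "simplicial_set (Fo j)" if "j \<in> ob J" for j
    using D.on_ob[OF that] by (simp add: ob_nsSet_iff)
  have Fa: "dm J u \<in> ob J" "cd J u \<in> ob J" "Fa u \<in> hom nsSet (Fo (dm J u)) (Fo (cd J u))"
    if "u \<in> arr J" for u
    using that D.J.dm_ob D.J.cd_ob D.on_hom by (auto simp: hom_def)
  let ?S = "coproduct (ob J) Fo"
  have S_iff: "(j, x) \<in> simp ?S n \<longleftrightarrow> j \<in> ob J \<and> x \<in> simp (Fo j) n" for j x n
    by (simp add: coproduct_def)
  have act_S: "act ?S m n \<alpha> (j, x) = (j, act (Fo j) m n \<alpha> x)" for m n \<alpha> j x
    by (simp add: coproduct_def)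
  have S: "simplicial_set ?S"
  proof
    fix m n \<alpha> s assume "\<alpha> \<in> simplex_hom m n" "s \<in> simp ?S n"
    then show "act ?S m n \<alpha> s \<in> simp ?S m"
      by (cases s) (simp add: S_iff act_S simplicial_set.act_closed[OF Fo])
  next
    fix n s assume "s \<in> simp ?S n"
    then show "act ?S n n (\<lambda>i\<in>{..n}. i) s = s"
      by (cases s) (simp add: S_iff act_S simplicial_set.act_id[OF Fo])
  next
    fix k m n \<beta> \<alpha> s assume "\<beta> \<in> simplex_hom k m" "\<alpha> \<in> simplex_hom m n" "s \<in> simp ?S n"
    then show "act ?S k m \<beta> (act ?S m n \<alpha> s) = act ?S k n (compose {..k} \<alpha> \<beta>) s"
      by (cases s) (simp add: S_iff act_S simplicial_set.act_comp[OF Fo])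
  qed
  have small_S: "small TYPE('u) (simp ?S n)" for n
  proof -
    have "small TYPE('u) (SIGMA j:ob J. simp (Fo j) n)"
      by (rule small_Sigma[OF U]) (use J D.on_ob in \<open>auto simp: small_category_def ob_nsSet_iff\<close>)
    then show ?thesis
      by (simp add: coproduct_def)
  qed
  define R where "R n s t \<longleftrightarrow> (\<exists>u\<in>arr J. \<exists>x\<in>simp (Fo (dm J u)) n.
      s = (dm J u, x) \<and> t = (cd J u, app (Fa u) n x))" for n s t
  have R_S: "s \<in> simp ?S n \<and> t \<in> simp ?S n" if st: "R n s t" for n s t
  proof -
    obtain u x where "u \<in> arr J" "x \<in> simp (Fo (dm J u)) n" "s = (dm J u, x)"
      "t = (cd J u, app (Fa u) n x)"
      using st unfolding R_def by blast
    then show ?thesis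
      using Fa[of u] app_closed[OF Fa(3)] by (simp add: S_iff)
  qed
  obtain L :: "'u sset" and \<pi> where L: "L \<in> ob nsSet"
    and \<pi>: "nonsingular_quotient ?S (collapse ?S R) L \<pi>"
    by (rule nonsingular_quotient_exists[OF S small_S collapse_congruence collapse_vertex_closed])
  note \<pi> = nonsingular_quotientD[OF \<pi>]
  have "\<exists>f. f \<in> hom nsSet (Fo j) L \<and> (\<forall>n. \<forall>x\<in>simp (Fo j) n. app f n x = \<pi> n (j, x))"
    if j: "j \<in> ob J" for j
  proof (rule hom_exists[OF D.on_ob[OF j] L, of "\<lambda>n x. \<pi> n (j, x)"])
    fix m n \<alpha> x assume "\<alpha> \<in> simplex_hom m n" "x \<in> simp (Fo j) n"
    then show "\<pi> m (j, act (Fo j) m n \<alpha> x) = act L m n \<alpha> (\<pi> n (j, x))"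
      using \<pi>(3)[of \<alpha> m n "(j, x)"] j by (simp add: S_iff act_S)
  qed (use j in \<open>auto simp: \<pi>(1) S_iff\<close>)
  then obtain p where p: "\<And>j. j \<in> ob J \<Longrightarrow> p j \<in> hom nsSet (Fo j) L"
    "\<And>j n x. \<lbrakk>j \<in> ob J; x \<in> simp (Fo j) n\<rbrakk> \<Longrightarrow> app (p j) n x = \<pi> n (j, x)"
    by metis
  have "is_colimit J nsSet Fo Fa L p"
    unfolding is_colimit_def
  proof (intro conjI allI impI)
    show "is_cocone J nsSet Fo Fa L p"
      unfolding is_cocone_def
    proof (intro conjI ballI)
      fix u assume u: "u \<in> arr J"
      show "cmp nsSet (p (cd J u)) (Fa u) = p (dm J u)"
      proof (rule hom_eqI[OF cmp_nsSet_hom[OF Fa(3)[OF u] p(1)[OF Fa(2)[OF u]]] p(1)[OF Fa(1)[OF u]]])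
        fix n x assume x: "x \<in> simp (Fo (dm J u)) n"
        have "R n (dm J u, x) (cd J u, app (Fa u) n x)"
          using u x by (auto simp: R_def)
        then have "\<pi> n (dm J u, x) = \<pi> n (cd J u, app (Fa u) n x)"
          using R_S \<pi>(2) by (simp add: collapse.gen)
        then show "app (cmp nsSet (p (cd J u)) (Fa u)) n x = app (p (dm J u)) n x"
          using Fa[OF u] x by (simp add: app_cmp[OF Fa(3)[OF u]] p(2) app_closed[OF Fa(3)[OF u]])
      qed
    qed (use L p in auto)
  next
    fix M q assume "is_cocone J nsSet Fo Fa M q"
    then have M: "M \<in> ob nsSet" and q: "\<And>j. j \<in> ob J \<Longrightarrow> q j \<in> hom nsSet (Fo j) M"
      and q_cocone: "\<And>u. u \<in> arr J \<Longrightarrow> cmp nsSet (q (cd J u)) (Fa u) = q (dm J u)"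
      by (auto simp: is_cocone_def)
    define g where "g n s = app (q (fst s)) n (snd s)" for n s
    have g: "g n s \<in> simp M n" if "s \<in> simp ?S n" for n s
      using that by (cases s) (simp add: g_def S_iff app_closed[OF q])
    have g_act: "g m (act ?S m n \<alpha> s) = act M m n \<alpha> (g n s)"
      if "\<alpha> \<in> simplex_hom m n" "s \<in> simp ?S n" for m n \<alpha> s
      using that by (cases s) (simp add: g_def S_iff act_S app_act[OF q])
    have g_R: "s \<in> simp ?S n \<and> t \<in> simp ?S n \<and> g n s = g n t" if st: "R n s t" for n s t
    proof -
      obtain u x where *: "u \<in> arr J" "x \<in> simp (Fo (dm J u)) n" "s = (dm J u, x)"
        "t = (cd J u, app (Fa u) n x)"
        using st unfolding R_def by blast
      then show ?thesis
        using R_S[OF st] app_cmp[OF Fa(3)[OF *(1)] *(2), of "q (cd J u)"] q_cocone[OF *(1)]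
        by (simp add: g_def)
    qed
    have g_eq: "g n s = g n t" if "collapse ?S R n s t" for n s t
    proof (rule collapse_least[where M = M and g = g, OF S _ g_R g g_act that])
      show "vertex_closed M (\<lambda>_. (=))"
        using M by (simp add: ob_nsSet_iff)
    qed
    let ?rep = "\<lambda>n. inv_into (simp ?S n) (\<pi> n)"
    have rep: "?rep n (\<pi> n s) \<in> simp ?S n" "g n (?rep n (\<pi> n s)) = g n s" if s: "s \<in> simp ?S n" for n s
    proof -
      have "\<pi> n s \<in> \<pi> n ` simp ?S n"
        using s by blast
      from inv_into_into[OF this] f_inv_into_f[OF this]
      have *: "?rep n (\<pi> n s) \<in> simp ?S n" "\<pi> n (?rep n (\<pi> n s)) = \<pi> n s" .
      then show "?rep n (\<pi> n s) \<in> simp ?S n" "g n (?rep n (\<pi> n s)) = g n s"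
        using \<pi>(2)[OF *(1) s] g_eq by simp_all
    qed
    have simp_L: "\<exists>s\<in>simp ?S n. z = \<pi> n s" if "z \<in> simp L n" for n z
      using that by (auto simp: \<pi>(1))
    obtain h where h: "h \<in> hom nsSet L M" "\<And>n z. z \<in> simp L n \<Longrightarrow> app h n z = g n (?rep n z)"
    proof (rule hom_exists[OF L M, of "\<lambda>n z. g n (?rep n z)"])
      fix n z assume "z \<in> simp L n"
      with simp_L obtain s where s: "s \<in> simp ?S n" "z = \<pi> n s" by blast
      then show "g n (?rep n z) \<in> simp M n"
        using rep(2)[OF s(1)] g by simp
    next
      fix m n \<alpha> z assume \<alpha>: "\<alpha> \<in> simplex_hom m n" and "z \<in> simp L n"
      with simp_L obtain s where s: "s \<in> simp ?S n" "z = \<pi> n s" by blast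
      then show "g m (?rep m (act L m n \<alpha> z)) = act M m n \<alpha> (g n (?rep n z))"
        using \<alpha> simplicial_set.act_closed[OF S \<alpha>]
        by (simp add: \<pi>(3)[symmetric] rep(2) g_act)
    qed (rule that)
    have h_\<pi>: "app h n (\<pi> n s) = g n s" if "s \<in> simp ?S n" for n s
      using that h(2)[of "\<pi> n s" n] rep(2) by (simp add: \<pi>(1))
    show "\<exists>!h. h \<in> hom nsSet L M \<and> (\<forall>j\<in>ob J. cmp nsSet h (p j) = q j)"
    proof (intro ex1I conjI ballI)
      show "h \<in> hom nsSet L M" by (rule h)
      fix j assume j: "j \<in> ob J"
      show "cmp nsSet h (p j) = q j"
      proof (rule hom_eqI[OF cmp_nsSet_hom[OF p(1)[OF j] h(1)] q[OF j]])
        fix n x assume "x \<in> simp (Fo j) n"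
        then show "app (cmp nsSet h (p j)) n x = app (q j) n x"
          using j by (simp add: app_cmp[OF p(1)[OF j]] p(2) h_\<pi> S_iff g_def)
      qed
    next
      fix h' assume h': "h' \<in> hom nsSet L M \<and> (\<forall>j\<in>ob J. cmp nsSet h' (p j) = q j)"
      show "h' = h"
      proof (rule hom_eqI[OF conjunct1[OF h'] h(1)])
        fix n z assume "z \<in> simp L n"
        with simp_L obtain j x where "(j, x) \<in> simp ?S n" "z = \<pi> n (j, x)"
          by (metis surj_pair)
        then have s: "j \<in> ob J" "x \<in> simp (Fo j) n" "z = \<pi> n (j, x)" "(j, x) \<in> simp ?S n"
          by (simp_all add: S_iff)
        have "app h' n z = app (cmp nsSet h' (p j)) n x"
          using s by (simp add: app_cmp[OF p(1)[OF s(1)] s(2)] p(2))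
        also have "\<dots> = g n (j, x)"
          using h' s by (simp add: g_def)
        finally show "app h' n z = app h n z"
          using s by (simp add: h_\<pi>)
      qed
    qed
  qed
  then show "\<exists>L p. is_colimit J nsSet Fo Fa L p"
    by blast
qed

section \<open>Exponentials\<close>

text \<open>The simplices of \<open>A \<times> \<Delta>[n]\<close>, of all dimensions together; the first component is the dimension.\<close>

definition prism :: "'u sset \<Rightarrow> nat \<Rightarrow> (nat \<times> 'u \<times> (nat \<Rightarrow> nat)) set" where
  "prism A n = (SIGMA m:UNIV. simp A m \<times> simplex_hom m n)"

text \<open>The usual internal hom of simplicial sets: its \<open>n\<close>-simplices are the simplicial maps
  \<open>A \<times> \<Delta>[n] \<rightarrow> B\<close>, written as single functions on all simplices of the prism so that
  they form a subset of one function space.\<close>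

definition mapping_space ::
  "'u sset \<Rightarrow> 'u sset \<Rightarrow> (nat \<times> 'u \<times> (nat \<Rightarrow> nat) \<Rightarrow> 'u) sset" where
  "mapping_space A B = \<lparr>
     simp = (\<lambda>n. {f \<in> \<Pi>\<^sub>E (m, x, \<alpha>)\<in>prism A n. simp B m.
        \<forall>k m. \<forall>\<beta>\<in>simplex_hom k m. \<forall>x\<in>simp A m. \<forall>\<alpha>\<in>simplex_hom m n.
          f (k, act A k m \<beta> x, compose {..k} \<alpha> \<beta>) = act B k m \<beta> (f (m, x, \<alpha>))}),
     act = (\<lambda>m n \<gamma> f. \<lambda>(k, x, \<alpha>)\<in>prism A m. f (k, x, compose {..k} \<gamma> \<alpha>))\<rparr>"

lemma mem_prism: "(m, x, \<alpha>) \<in> prism A n \<longleftrightarrow> x \<in> simp A m \<and> \<alpha> \<in> simplex_hom m n"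
  by (simp add: prism_def)

lemma act_mapping_space:
  "\<lbrakk>x \<in> simp A k; \<alpha> \<in> simplex_hom k m\<rbrakk>
    \<Longrightarrow> act (mapping_space A B) m n \<gamma> f (k, x, \<alpha>) = f (k, x, compose {..k} \<gamma> \<alpha>)"
  by (simp add: mapping_space_def mem_prism)

lemma mapping_spaceD:
  assumes "f \<in> simp (mapping_space A B) n"
  shows "\<lbrakk>x \<in> simp A m; \<alpha> \<in> simplex_hom m n\<rbrakk> \<Longrightarrow> f (m, x, \<alpha>) \<in> simp B m"
    and "\<lbrakk>\<beta> \<in> simplex_hom k m; x \<in> simp A m; \<alpha> \<in> simplex_hom m n\<rbrakk>
      \<Longrightarrow> f (k, act A k m \<beta> x, compose {..k} \<alpha> \<beta>) = act B k m \<beta> (f (m, x, \<alpha>))"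
proof -
  have f: "f \<in> (\<Pi>\<^sub>E (m, x, \<alpha>)\<in>prism A n. simp B m)"
    using assms by (simp add: mapping_space_def)
  show "f (m, x, \<alpha>) \<in> simp B m" if "x \<in> simp A m" "\<alpha> \<in> simplex_hom m n"
    using PiE_mem[OF f, of "(m, x, \<alpha>)"] that by (simp add: mem_prism)
  show "f (k, act A k m \<beta> x, compose {..k} \<alpha> \<beta>) = act B k m \<beta> (f (m, x, \<alpha>))"
    if "\<beta> \<in> simplex_hom k m" "x \<in> simp A m" "\<alpha> \<in> simplex_hom m n"
    using assms that by (simp add: mapping_space_def)
qed

lemma mapping_space_restrictI:
  assumes A: "simplicial_set A"
    and "\<And>m x \<alpha>. \<lbrakk>x \<in> simp A m; \<alpha> \<in> simplex_hom m n\<rbrakk> \<Longrightarrow> f m x \<alpha> \<in> simp B m"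
    and "\<And>k m \<beta> x \<alpha>. \<lbrakk>\<beta> \<in> simplex_hom k m; x \<in> simp A m; \<alpha> \<in> simplex_hom m n\<rbrakk>
      \<Longrightarrow> f k (act A k m \<beta> x) (compose {..k} \<alpha> \<beta>) = act B k m \<beta> (f m x \<alpha>)"
  shows "(\<lambda>(m, x, \<alpha>)\<in>prism A n. f m x \<alpha>) \<in> simp (mapping_space A B) n"
  using assms(2,3)
  by (auto simp: mapping_space_def mem_prism simplicial_set.act_closed[OF A] simplex_compose)

lemma mapping_space_eqI:
  assumes f: "f \<in> simp (mapping_space A B) n" and g: "g \<in> simp (mapping_space A B) n"
    and eq: "\<And>m x \<alpha>. \<lbrakk>x \<in> simp A m; \<alpha> \<in> simplex_hom m n\<rbrakk> \<Longrightarrow> f (m, x, \<alpha>) = g (m, x, \<alpha>)"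
  shows "f = g"
proof (rule PiE_ext)
  show "f \<in> (\<Pi>\<^sub>E (m, x, \<alpha>)\<in>prism A n. simp B m)" "g \<in> (\<Pi>\<^sub>E (m, x, \<alpha>)\<in>prism A n. simp B m)"
    using f g by (simp_all add: mapping_space_def)
  fix t assume "t \<in> prism A n"
  then show "f t = g t"
    by (cases t) (simp add: eq mem_prism)
qed

lemma simplicial_set_mapping_space:
  assumes A: "simplicial_set A"
  shows "simplicial_set (mapping_space A B)"
proof -
  have closed: "act (mapping_space A B) m n \<gamma> f \<in> simp (mapping_space A B) m"
    if \<gamma>: "\<gamma> \<in> simplex_hom m n" and f: "f \<in> simp (mapping_space A B) n" for m n \<gamma> f
  proof -
    have "(\<lambda>(k, x, \<alpha>)\<in>prism A m. f (k, x, compose {..k} \<gamma> \<alpha>)) \<in> simp (mapping_space A B) m"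
      by (rule mapping_space_restrictI[OF A])
        (simp_all add: mapping_spaceD[OF f] simplex_compose \<gamma> simplex_compose_assoc[symmetric])
    then show ?thesis
      by (simp add: mapping_space_def)
  qed
  show ?thesis
  proof
    fix n f assume f: "f \<in> simp (mapping_space A B) n"
    show "act (mapping_space A B) n n (\<lambda>i\<in>{..n}. i) f = f"
      by (rule mapping_space_eqI[OF closed[OF simplex_id f] f])
        (simp add: act_mapping_space simplex_compose_id_left)
  next
    fix k m n \<beta> \<alpha> f
    assume \<beta>: "\<beta> \<in> simplex_hom k m" and \<alpha>: "\<alpha> \<in> simplex_hom m n" and f: "f \<in> simp (mapping_space A B) n"
    show "act (mapping_space A B) k m \<beta> (act (mapping_space A B) m n \<alpha> f) =
        act (mapping_space A B) k n (compose {..k} \<alpha> \<beta>) f"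
      by (rule mapping_space_eqI[OF closed[OF \<beta> closed[OF \<alpha> f]] closed[OF simplex_compose[OF \<beta> \<alpha>] f]])
        (simp add: act_mapping_space simplex_compose[OF _ \<beta>] simplex_compose_assoc)
  qed (fact closed)
qed

lemma small_mapping_space:
  assumes U: "universe TYPE('u)"
    and A: "\<And>m. small TYPE('u) (simp A m)" and B: "\<And>m. small TYPE('u) (simp B m)"
  shows "small TYPE('u) (simp (mapping_space A B) n)"
proof (rule small_subset)
  have "small TYPE('u) (prism A n)"
    unfolding prism_def
    by (intro small_Sigma small_nat U A small_finite finite_simplex_hom)
  then show "small TYPE('u) (\<Pi>\<^sub>E (m, x, \<alpha>)\<in>prism A n. simp B m)"
    by (rule small_PiE[OF U]) (simp add: B case_prod_beta)
qed (auto simp: mapping_space_def)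

text \<open>Let \<open>f : A \<times> \<Delta>[n] \<rightarrow> B\<close> have equal vertices \<open>a < b\<close>, that is, equal restrictions to
  \<open>A \<times> {a}\<close> and \<open>A \<times> {b}\<close>. For a vertex \<open>x\<close> of \<open>A\<close>, the simplex \<open>f(x, -)\<close> of \<open>B\<close> has equal vertices \<open>a\<close> and \<open>b\<close>, so
  the Horn condition in \<open>B\<close> gives \<open>f(x, a) = f(x, a + 1)\<close>. For a simplex \<open>(x, \<alpha>)\<close> of dimension \<open>m\<close>,
  the values of \<open>\<alpha>\<close> equal to \<open>a + 1\<close> are lowered to \<open>a\<close> one position at a time, from left to right, so
  that monotonicity is kept. Each single change, at position \<open>t\<close>, is a passage between the faces
  opposite to \<open>t\<close> and \<open>t + 1\<close> of a simplex of dimension \<open>m + 1\<close> in the prism, in which the vertex \<open>t\<close>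
  is doubled. Its image in \<open>B\<close> has equal vertices \<open>t\<close> and \<open>t + 1\<close> by the case of dimension \<open>0\<close>, so
  the Horn condition in \<open>B\<close> makes the two faces agree.\<close>

lemma vertex_closed_mapping_space:
  assumes A: "simplicial_set A" and B: "simplicial_set B"
    and B_closed: "vertex_closed B (\<lambda>_. (=))"
  shows "vertex_closed (mapping_space A B) (\<lambda>_. (=))"
  unfolding vertex_closed_def
proof (intro allI ballI impI)
  let ?E = "mapping_space A B"
  fix n a b f
  assume f: "f \<in> simp ?E n" and ab: "a < b" "b \<le> n"
    and eq: "act ?E 0 n (vertex a) f = act ?E 0 n (vertex b) f"
  interpret E: simplicial_set ?E by (rule simplicial_set_mapping_space[OF A])
  note f_closed = mapping_spaceD(1)[OF f] and f_nat = mapping_spaceD(2)[OF f]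
  have edge: "f (0, x, vertex a) = f (0, x, vertex (Suc a))" if x: "x \<in> simp A 0" for x
  proof -
    let ?c = "\<lambda>i\<in>{..n}. 0"
    let ?x = "act A n 0 ?c x"
    let ?z = "f (n, ?x, \<lambda>i\<in>{..n}. i)"
    have c: "?c \<in> simplex_hom n 0"
      by (rule simplex_homI) auto
    have x': "?x \<in> simp A n"
      using simplicial_set.act_closed[OF A c x] .
    have z: "?z \<in> simp B n"
      using f_closed[OF x' simplex_id] .
    have vert: "act B 0 n (vertex i) ?z = f (0, x, vertex i)" if i: "i \<le> n" for i
    proof -
      have "act A 0 n (vertex i) ?x = act A 0 0 (vertex (?c i)) x"
        using simplicial_set.act_vertex[OF A c x i] .
      also have "vertex (?c i) = (\<lambda>i\<in>{..0}. i)"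
        using i by (auto simp: vertex_def fun_eq_iff)
      also have "act A 0 0 (\<lambda>i\<in>{..0}. i) x = x"
        by (rule simplicial_set.act_id[OF A x])
      finally show ?thesis
        using f_nat[OF vertex_hom[OF i] x' simplex_id]
        by (simp only: simplex_compose_id_left[OF vertex_hom[OF i]])
    qed
    have f_vert: "act ?E 0 n (vertex i) f (0, x, (\<lambda>i\<in>{..0}. i)) = f (0, x, vertex i)" if "i \<le> n" for i
      by (simp only: act_mapping_space[OF x simplex_id] simplex_compose_id_right[OF vertex_hom[OF that]])
    have "act B 0 n (vertex a) ?z = act B 0 n (vertex b) ?z"
      using vert[of a] vert[of b] f_vert[of a] f_vert[of b] eq ab by simp
    then have "act B n n (fold_edge n a) ?z = ?z"
      using vertex_closedD[OF B_closed z ab] by simp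
    then have "act B 0 n (vertex (Suc a)) ?z = act B 0 n (vertex (fold_edge n a (Suc a))) ?z"
      using simplicial_set.act_vertex[OF B fold_edge_hom[of n a] z, of "Suc a"] ab by simp
    moreover have "fold_edge n a (Suc a) = a"
      using ab by (simp add: fold_edge_def)
    ultimately show ?thesis
      using vert[of a] vert[of "Suc a"] ab by simp
  qed
  show "act ?E n n (fold_edge n a) f = f"
  proof (rule mapping_space_eqI[OF E.act_closed[OF fold_edge_hom f] f])
    fix m x \<alpha> assume x: "x \<in> simp A m" and \<alpha>: "\<alpha> \<in> simplex_hom m n"
    define \<epsilon> where "\<epsilon> i = (if \<alpha> i = Suc a then a else \<alpha> i)" for i
    have \<epsilon>_le: "\<epsilon> i \<le> \<alpha> i" for i
      by (simp add: \<epsilon>_def)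
    have \<epsilon>_mono: "\<epsilon> i \<le> \<epsilon> j" if "i \<le> j" "j \<le> m" for i j
      using simplex_hom_mono[OF \<alpha> that] by (auto simp: \<epsilon>_def)
    have \<alpha>_le: "\<alpha> i \<le> n" if "i \<le> m" for i
      using simplex_hom_le[OF \<alpha> that] .
    have \<alpha>_mono: "\<alpha> i \<le> \<alpha> j" if "i \<le> j" "j \<le> m" for i j
      using simplex_hom_mono[OF \<alpha> that] .
    \<comment> \<open>\<open>\<epsilon>\<close> is the fully lowered operator, and \<open>\<phi> t\<close> is \<open>\<alpha>\<close> with the first \<open>t\<close> positions lowered.\<close>
    define \<phi> where "\<phi> t = (\<lambda>i\<in>{..m}. if i < t then \<epsilon> i else \<alpha> i)" for t
    have step: "f (m, x, \<phi> t) = f (m, x, \<phi> (Suc t))" if t: "t \<le> m" for t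
    proof -
      \<comment> \<open>\<open>(\<sigma>\<^sup>* x, \<psi>)\<close> is the simplex of the prism with the vertex \<open>t\<close> doubled, and \<open>\<delta> s\<close> is the face
        operator that omits \<open>s\<close>.\<close>
      define \<sigma> where "\<sigma> = (\<lambda>i\<in>{..Suc m}. if i \<le> t then i else i - 1)"
      define \<psi> where "\<psi> = (\<lambda>i\<in>{..Suc m}. if i \<le> t then \<epsilon> i else \<alpha> (i - 1))"
      define \<delta> where "\<delta> t = (\<lambda>i\<in>{..m}. if i < t then i else Suc i)" for t
      have \<sigma>: "\<sigma> \<in> simplex_hom (Suc m) m"
        unfolding \<sigma>_def by (rule simplex_homI) (use t in auto)
      have \<psi>: "\<psi> \<in> simplex_hom (Suc m) n"
        unfolding \<psi>_def
      proof (rule simplex_homI)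
        fix i assume "i \<le> Suc m"
        then show "(if i \<le> t then \<epsilon> i else \<alpha> (i - 1)) \<le> n"
          using \<epsilon>_le[of i] \<alpha>_le[of i] \<alpha>_le[of "i - 1"] t by auto
      next
        fix i j assume ij: "i \<le> j" "j \<le> Suc m"
        show "(if i \<le> t then \<epsilon> i else \<alpha> (i - 1)) \<le> (if j \<le> t then \<epsilon> j else \<alpha> (j - 1))"
          using ij t \<epsilon>_mono[of i j] \<alpha>_mono[of "i - 1" "j - 1"]
            le_trans[OF \<epsilon>_le[of i] \<alpha>_mono[of i "j - 1"]] by auto
      qed
      have \<delta>: "\<delta> s \<in> simplex_hom m (Suc m)" for s
        unfolding \<delta>_def by (rule simplex_homI) auto
      let ?x = "act A (Suc m) m \<sigma> x"
      let ?w = "f (Suc m, ?x, \<psi>)"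
      have x': "?x \<in> simp A (Suc m)"
        using simplicial_set.act_closed[OF A \<sigma> x] .
      have w: "?w \<in> simp B (Suc m)"
        using f_closed[OF x' \<psi>] .
      have face: "act B m (Suc m) (\<delta> s) ?w = f (m, x, \<phi> s)" if s: "s = t \<or> s = Suc t" for s
      proof -
        have "compose {..m} \<sigma> (\<delta> s) = (\<lambda>i\<in>{..m}. i)"
          using s t by (auto simp: compose_def fun_eq_iff \<sigma>_def \<delta>_def)
        then have "act A m (Suc m) (\<delta> s) ?x = x"
          using simplicial_set.act_comp[OF A \<delta>[of s] \<sigma> x] simplicial_set.act_id[OF A x] by simp
        moreover have "compose {..m} \<psi> (\<delta> s) = \<phi> s"
          using s t by (auto simp: compose_def fun_eq_iff \<phi>_def \<psi>_def \<delta>_def)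
        ultimately show ?thesis
          using f_nat[OF \<delta>[of s] x' \<psi>] by simp
      qed
      have vert: "act B 0 (Suc m) (vertex i) ?w = f (0, act A 0 m (vertex t) x, vertex (\<psi> i))"
        if i: "i = t \<or> i = Suc t" for i
      proof -
        have i': "i \<le> Suc m" "\<sigma> i = t"
          using i t by (auto simp: \<sigma>_def)
        show ?thesis
          using f_nat[OF vertex_hom[OF i'(1)] x' \<psi>] simplicial_set.act_vertex[OF A \<sigma> x i'(1)] i'(2)
          by (simp only: compose_vertex[OF i'(1)])
      qed
      have xt: "act A 0 m (vertex t) x \<in> simp A 0"
        using simplicial_set.act_closed[OF A vertex_hom[OF t] x] .
      have "\<psi> t = \<epsilon> t" "\<psi> (Suc t) = \<alpha> t"
        using t by (auto simp: \<psi>_def)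
      then have "act B 0 (Suc m) (vertex t) ?w = act B 0 (Suc m) (vertex (Suc t)) ?w"
        using vert[of t] vert[of "Suc t"] edge[OF xt] by (cases "\<alpha> t = Suc a") (simp_all add: \<epsilon>_def)
      then have "act B (Suc m) (Suc m) (fold_edge (Suc m) t) ?w = ?w"
        using vertex_closedD[OF B_closed w, of t "Suc t"] t by simp
      then have "act B m (Suc m) (\<delta> t) ?w =
          act B m (Suc m) (compose {..m} (fold_edge (Suc m) t) (\<delta> t)) ?w"
        using simplicial_set.act_comp[OF B \<delta>[of t] fold_edge_hom[of _ t] w] by simp
      also have "compose {..m} (fold_edge (Suc m) t) (\<delta> t) = \<delta> (Suc t)"
        using t by (auto simp: compose_def fun_eq_iff fold_edge_def \<delta>_def)
      finally show ?thesis
        using face[of t] face[of "Suc t"] by simp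
    qed
    have "f (m, x, \<phi> 0) = f (m, x, \<phi> t)" if "t \<le> Suc m" for t
      using that by (induction t) (simp_all add: step)
    then have "f (m, x, \<phi> 0) = f (m, x, \<phi> (Suc m))"
      by simp
    moreover have "\<phi> 0 = \<alpha>"
      using \<alpha> unfolding \<phi>_def by (subst simplex_hom_eq_iff[OF simplex_homI \<alpha>]) (simp_all add: \<alpha>_le \<alpha>_mono)
    moreover have "\<phi> (Suc m) = compose {..m} (fold_edge n a) \<alpha>"
      using \<alpha>_le by (auto simp: \<phi>_def \<epsilon>_def compose_def fold_edge_def fun_eq_iff)
    ultimately show "act ?E n n (fold_edge n a) f (m, x, \<alpha>) = f (m, x, \<alpha>)"
      using x \<alpha> by (simp add: act_mapping_space)
  qed
qed

text \<open>A map \<open>f\<close> from a product of \<open>X\<close> and \<open>A\<close> is transposed to the map that sends an \<open>n\<close>-simplex \<open>y\<close> of \<open>X\<close> to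
  \<open>(x, \<alpha>) \<mapsto> f(\<alpha>\<^sup>* y, x)\<close>, and evaluation applies a simplex of the mapping space to the
  pair of a simplex of \<open>A\<close> and the identity operator.\<close>

lemma exponential_exists:
  fixes A B :: "'u sset"
  assumes U: "universe TYPE('u)" and A: "A \<in> ob nsSet" and B: "B \<in> ob nsSet"
  shows "\<exists>E P p q ev. is_exponential nsSet A B E P p q ev"
proof -
  have A_sset: "simplicial_set A" and B_sset: "simplicial_set B"
    and small: "\<And>n. small TYPE('u) (simp A n)" "\<And>n. small TYPE('u) (simp B n)"
    and B_closed: "vertex_closed B (\<lambda>_. (=))"
    using A B by (simp_all add: ob_nsSet_iff)
  let ?F = "mapping_space A B"
  obtain E :: "'u sset" and \<pi> \<delta> where E: "E \<in> ob nsSet" and iso: "sset_iso ?F E \<pi> \<delta>"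
    by (rule nonsingular_copy[OF simplicial_set_mapping_space[OF A_sset]
          small_mapping_space[OF U small] vertex_closed_mapping_space[OF A_sset B_sset B_closed]])
  note \<pi>_closed = sset_isoD(1)[OF iso] and \<delta>_\<pi> = sset_isoD(2)[OF iso]
    and \<delta>_closed = sset_isoD(3)[OF iso] and \<pi>_\<delta> = sset_isoD(4)[OF iso]
    and \<pi>_act = sset_isoD(5)[OF iso] and \<delta>_act = sset_isoD(6)[OF iso]
  obtain P p q where P: "levelwise_product E A P p q"
    using levelwise_product_exists[OF U E A] by blast
  then have p: "p \<in> hom nsSet P E" and q: "q \<in> hom nsSet P A"
    by (simp_all add: levelwise_product_def)
  have P_prod: "is_product nsSet E A P p q"
    by (rule levelwise_product_is_product[OF P])
  have P_ob: "P \<in> ob nsSet"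
    using hom_ob(1)[OF p] .
  let ?id = "\<lambda>n::nat. \<lambda>i\<in>{..n}. i"
  obtain ev where ev: "ev \<in> hom nsSet P B"
    "\<And>n z. z \<in> simp P n \<Longrightarrow> app ev n z = \<delta> n (app p n z) (n, app q n z, ?id n)"
  proof (rule hom_exists[OF P_ob B, of "\<lambda>n z. \<delta> n (app p n z) (n, app q n z, ?id n)"])
    fix n z assume z: "z \<in> simp P n"
    show "\<delta> n (app p n z) (n, app q n z, ?id n) \<in> simp B n"
      by (rule mapping_spaceD(1)[OF \<delta>_closed[OF app_closed[OF p z]] app_closed[OF q z] simplex_id])
  next
    fix m n \<alpha> z assume \<alpha>: "\<alpha> \<in> simplex_hom m n" and z: "z \<in> simp P n"
    have p_z: "app p n z \<in> simp E n" and q_z: "app q n z \<in> simp A n"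
      using app_closed[OF p z] app_closed[OF q z] .
    have "\<delta> m (app p m (act P m n \<alpha> z)) (m, app q m (act P m n \<alpha> z), ?id m) =
        \<delta> n (app p n z) (m, act A m n \<alpha> (app q n z), compose {..m} \<alpha> (?id m))"
      using act_mapping_space[OF ob_act_closed[OF A \<alpha> q_z] simplex_id]
      by (simp add: app_act[OF p \<alpha> z] app_act[OF q \<alpha> z] \<delta>_act[OF \<alpha> p_z])
    also have "compose {..m} \<alpha> (?id m) = compose {..m} (?id n) \<alpha>"
      by (simp only: simplex_compose_id_right[OF \<alpha>] simplex_compose_id_left[OF \<alpha>])
    also have "\<delta> n (app p n z) (m, act A m n \<alpha> (app q n z), compose {..m} (?id n) \<alpha>) =
        act B m n \<alpha> (\<delta> n (app p n z) (n, app q n z, ?id n))"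
      by (rule mapping_spaceD(2)[OF \<delta>_closed[OF p_z] \<alpha> q_z simplex_id])
    finally show "\<delta> m (app p m (act P m n \<alpha> z)) (m, app q m (act P m n \<alpha> z), ?id m) =
        act B m n \<alpha> (\<delta> n (app p n z) (n, app q n z, ?id n))" .
  qed (rule that)
  have "\<exists>!h. h \<in> hom nsSet X E \<and>
      (\<exists>t\<in>hom nsSet Q P. cmp nsSet p t = cmp nsSet h r \<and> cmp nsSet q t = s \<and> cmp nsSet ev t = f)"
    if Q_prod: "is_product nsSet X A Q r s" and f: "f \<in> hom nsSet Q B" for X Q r s f
  proof -
    have r: "r \<in> hom nsSet Q X" and s: "s \<in> hom nsSet Q A"
      using Q_prod by (simp_all add: is_product_def)
    have X: "X \<in> ob nsSet" and Q: "Q \<in> ob nsSet"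
      using hom_ob[OF r] by simp_all
    have bij: "bij_betw (\<lambda>z. (app r n z, app s n z)) (simp Q n) (simp X n \<times> simp A n)" for n
      using product_levelwise[OF U X A Q_prod] by (simp add: levelwise_product_def)
    \<comment> \<open>\<open>pr n y x\<close> is the simplex of \<open>Q\<close> with projections \<open>y\<close> and \<open>x\<close>.\<close>
    define pr where "pr n y x = inv_into (simp Q n) (\<lambda>z. (app r n z, app s n z)) (y, x)" for n y x
    have pr: "pr n y x \<in> simp Q n" "app r n (pr n y x) = y" "app s n (pr n y x) = x"
      if "y \<in> simp X n" "x \<in> simp A n" for n y x
    proof -
      have "(y, x) \<in> (\<lambda>z. (app r n z, app s n z)) ` simp Q n"
        using bij_betw_imp_surj_on[OF bij] that by simp
      from inv_into_into[OF this] f_inv_into_f[OF this]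
      show "pr n y x \<in> simp Q n" "app r n (pr n y x) = y" "app s n (pr n y x) = x"
        by (simp_all add: pr_def)
    qed
    have pr_eq: "pr n (app r n z) (app s n z) = z" if "z \<in> simp Q n" for n z
      using inv_into_f_f[OF bij_betw_imp_inj_on[OF bij] that] by (simp add: pr_def)
    have pr_act: "pr m (act X m n \<alpha> y) (act A m n \<alpha> x) = act Q m n \<alpha> (pr n y x)"
      if \<alpha>: "\<alpha> \<in> simplex_hom m n" and yx: "y \<in> simp X n" "x \<in> simp A n" for m n \<alpha> y x
      using pr_eq[OF ob_act_closed[OF Q \<alpha> pr(1)[OF yx]]]
      by (simp add: app_act[OF r \<alpha>] app_act[OF s \<alpha>] pr yx)
    have X_comp: "act X k m \<beta> (act X m n \<alpha> y) = act X k n (compose {..k} \<alpha> \<beta>) y"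
      if "\<beta> \<in> simplex_hom k m" "\<alpha> \<in> simplex_hom m n" "y \<in> simp X n" for k m n \<alpha> \<beta> y
      using X that by (simp add: ob_nsSet_iff simplicial_set.act_comp)
    have X_id: "act X n n (?id n) y = y" if "y \<in> simp X n" for n y
      using X that by (simp add: ob_nsSet_iff simplicial_set.act_id)
    define g where "g n y = (\<lambda>(m, x, \<alpha>)\<in>prism A n. app f m (pr m (act X m n \<alpha> y) x))" for n y
    have g_app: "g n y (m, x, \<alpha>) = app f m (pr m (act X m n \<alpha> y) x)"
      if "x \<in> simp A m" "\<alpha> \<in> simplex_hom m n" for n y m x \<alpha>
      using that by (simp add: g_def mem_prism)
    have g: "g n y \<in> simp ?F n" if y: "y \<in> simp X n" for n y
      unfolding g_def
    proof (rule mapping_space_restrictI[OF A_sset])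
      fix m x \<alpha> assume "x \<in> simp A m" "\<alpha> \<in> simplex_hom m n"
      then show "app f m (pr m (act X m n \<alpha> y) x) \<in> simp B m"
        using y by (intro app_closed[OF f] pr ob_act_closed[OF X])
    next
      fix k m \<beta> x \<alpha>
      assume \<beta>: "\<beta> \<in> simplex_hom k m" and x: "x \<in> simp A m" and \<alpha>: "\<alpha> \<in> simplex_hom m n"
      note \<alpha>y = ob_act_closed[OF X \<alpha> y]
      have "pr k (act X k n (compose {..k} \<alpha> \<beta>) y) (act A k m \<beta> x) =
          act Q k m \<beta> (pr m (act X m n \<alpha> y) x)"
        using pr_act[OF \<beta> \<alpha>y x] X_comp[OF \<beta> \<alpha> y] by simp
      then show "app f k (pr k (act X k n (compose {..k} \<alpha> \<beta>) y) (act A k m \<beta> x)) =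
          act B k m \<beta> (app f m (pr m (act X m n \<alpha> y) x))"
        using app_act[OF f \<beta> pr(1)[OF \<alpha>y x]] by simp
    qed
    have g_act: "g m (act X m n \<gamma> y) = act ?F m n \<gamma> (g n y)"
      if \<gamma>: "\<gamma> \<in> simplex_hom m n" and y: "y \<in> simp X n" for m n \<gamma> y
    proof (rule mapping_space_eqI)
      show "g m (act X m n \<gamma> y) \<in> simp ?F m"
        by (rule g[OF ob_act_closed[OF X \<gamma> y]])
      show "act ?F m n \<gamma> (g n y) \<in> simp ?F m"
        by (rule simplicial_set.act_closed[OF simplicial_set_mapping_space[OF A_sset] \<gamma> g[OF y]])
      fix k x \<alpha> assume "x \<in> simp A k" "\<alpha> \<in> simplex_hom k m"
      then show "g m (act X m n \<gamma> y) (k, x, \<alpha>) = act ?F m n \<gamma> (g n y) (k, x, \<alpha>)"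
        by (simp add: act_mapping_space g_app simplex_compose[OF _ \<gamma>] X_comp \<gamma> y)
    qed
    obtain h where h: "h \<in> hom nsSet X E" "\<And>n y. y \<in> simp X n \<Longrightarrow> app h n y = \<pi> n (g n y)"
      by (rule hom_exists[OF X E, of "\<lambda>n y. \<pi> n (g n y)"]) (simp_all add: \<pi>_closed \<pi>_act g g_act)
    have hr: "cmp nsSet h r \<in> hom nsSet Q E"
      by (rule cmp_nsSet_hom[OF r h(1)])
    obtain t where t: "t \<in> hom nsSet Q P" "cmp nsSet p t = cmp nsSet h r" "cmp nsSet q t = s"
      using product_factor[OF P_prod hr s] by blast
    have ev_t: "app ev n (app t' n z) = \<delta> n (app h' n (app r n z)) (n, app s n z, ?id n)"
      if t': "t' \<in> hom nsSet Q P" "cmp nsSet p t' = cmp nsSet h' r" "cmp nsSet q t' = s"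
        and z: "z \<in> simp Q n" for h' t' n z
      using app_cmp[OF t'(1) z, of p] app_cmp[OF t'(1) z, of q] app_cmp[OF r z, of h']
      by (simp add: t'(2,3) ev(2) app_closed[OF t'(1) z])
    show ?thesis
    proof (rule ex1I[of _ h])
      have "cmp nsSet ev t = f"
      proof (rule hom_eqI[OF cmp_nsSet_hom[OF t(1) ev(1)] f])
        fix n z assume z: "z \<in> simp Q n"
        note r_z = app_closed[OF r z] and s_z = app_closed[OF s z]
        have "app ev n (app t n z) = g n (app r n z) (n, app s n z, ?id n)"
          using ev_t[OF t z] by (simp only: h(2)[OF r_z] \<delta>_\<pi>[OF g[OF r_z]])
        also have "\<dots> = app f n z"
          by (simp only: g_app[OF s_z simplex_id] X_id[OF r_z] pr_eq[OF z])
        finally show "app (cmp nsSet ev t) n z = app f n z"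
          by (simp add: app_cmp[OF t(1) z])
      qed
      then show "h \<in> hom nsSet X E \<and> (\<exists>t\<in>hom nsSet Q P. cmp nsSet p t = cmp nsSet h r \<and>
          cmp nsSet q t = s \<and> cmp nsSet ev t = f)"
        using h(1) t by blast
    next
      fix h' assume "h' \<in> hom nsSet X E \<and> (\<exists>t\<in>hom nsSet Q P. cmp nsSet p t = cmp nsSet h' r \<and>
          cmp nsSet q t = s \<and> cmp nsSet ev t = f)"
      then obtain t' where h': "h' \<in> hom nsSet X E" and t': "t' \<in> hom nsSet Q P"
        "cmp nsSet p t' = cmp nsSet h' r" "cmp nsSet q t' = s" and ev_t': "cmp nsSet ev t' = f"
        by blast
      show "h' = h"
      proof (rule hom_eqI[OF h' h(1)])
        fix n y assume y: "y \<in> simp X n"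
        note h'_y = app_closed[OF h' y]
        have "\<delta> n (app h' n y) = g n y"
        proof (rule mapping_space_eqI[OF \<delta>_closed[OF h'_y] g[OF y]])
          fix m x \<alpha> assume x: "x \<in> simp A m" and \<alpha>: "\<alpha> \<in> simplex_hom m n"
          note \<alpha>y = ob_act_closed[OF X \<alpha> y]
          have "g n y (m, x, \<alpha>) = app (cmp nsSet ev t') m (pr m (act X m n \<alpha> y) x)"
            by (simp add: g_app[OF x \<alpha>] ev_t')
          also have "\<dots> = \<delta> m (app h' m (act X m n \<alpha> y)) (m, x, ?id m)"
            using ev_t[OF t' pr(1)[OF \<alpha>y x]] by (simp add: app_cmp[OF t'(1) pr(1)[OF \<alpha>y x]] pr \<alpha>y x)
          also have "\<dots> = act ?F m n \<alpha> (\<delta> n (app h' n y)) (m, x, ?id m)"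
            by (simp only: app_act[OF h' \<alpha> y] \<delta>_act[OF \<alpha> h'_y])
          also have "\<dots> = \<delta> n (app h' n y) (m, x, \<alpha>)"
            by (simp only: act_mapping_space[OF x simplex_id] simplex_compose_id_right[OF \<alpha>])
          finally show "\<delta> n (app h' n y) (m, x, \<alpha>) = g n y (m, x, \<alpha>)" ..
        qed
        then show "app h' n y = app h n y"
          using \<pi>_\<delta>[OF h'_y] h(2)[OF y] by simp
      qed
    qed
  qed
  then have "is_exponential nsSet A B E P p q ev"
    using P_prod ev(1) unfolding is_exponential_def by blast
  then show ?thesis
    by blast
qed

theorem mainTheorem5:
  assumes "universe TYPE('u)"
  shows "category (nsSet :: ('u sset, ('u, 'u) smap) cat) \<and>
         cartesian_closed (nsSet :: ('u sset, ('u, 'u) smap) cat) \<and>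
         (\<forall>J :: ('j, 'k) cat. small_category TYPE('u) J \<longrightarrow>
            has_limits_of_shape J (nsSet :: ('u sset, ('u, 'u) smap) cat) \<and>
            has_colimits_of_shape J (nsSet :: ('u sset, ('u, 'u) smap) cat))"
proof (intro conjI allI impI)
  show "cartesian_closed (nsSet :: ('u sset, ('u, 'u) smap) cat)"
    unfolding cartesian_closed_def
    using terminal_nsSet[OF assms] levelwise_product_exists[OF assms] levelwise_product_is_product
      exponential_exists[OF assms] by metis
qed (use assms category_nsSet has_limits_nsSet has_colimits_nsSet in blast)+

end
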